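(* Let $D$ be a (possibly unbounded) self-adjoint operator on a Hilbert space $H$. The domain of definition $\mathrm{dom}(\delta_w^D)$ is a *-subalgebra of $B(H)$ which is dense in $B(H)$ in the strong operator topology, and $\delta_w^D$ is a *-derivation of this algebra into $B(H)$ which extends $\delta_u^D$. The graph of $\delta_w^D$ is closed in the weak operator topology on $B(H)\oplus B(H)$, and $\mathrm{dom}(\delta_w^D)$ is a Banach *-algebra under the norm $\|a\|_D:=\|a\|+\|\delta_w^D(a)\|$.
   Context: $B(H)$ is the algebra of bounded operators on $H$ with operator norm $\|\cdot\|$. For $t\in\mathbb{R}$ and $a\in B(H)$ let $\alpha_t(a):=e^{itD}ae^{-itD}$. An operator $a\in B(H)$ is weakly $D$-differentiable if there is a bounded operator $b$ on $H$ with $\lim_{t\to0}|\langle(\frac{\alpha_t(a)-a}{t}-b)\xi,\eta\rangle|=0$ for all $\xi,\eta\in H$; then $b$ is called the weak $D$-derivative of $a$ and denoted $\delta_w^D(a)$. The domain $\mathrm{dom}(\delta_w^D)$ is the set of all weakly $D$-differentiable operators in $B(H)$. An operator $a\in B(H)$ is uniformly $D$-differentiable if there is a bounded operator $b$ on $H$ with $\lim_{t\to0}\|\frac{\alpha_t(a)-a}{t}-b\|=0$; then $b$ is called the uniform $D$-derivative of $a$ and denoted $\delta_u^D(a)$. The domain $\mathrm{dom}(\delta_u^D)$ is the set of all uniformly $D$-differentiable operators in $B(H)$. A *-derivation is a linear map $\delta$ with $\delta(ab)=\delta(a)b+a\delta(b)$ and $\delta(a^* )=\delta(a)^*$ on its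 domain. *)

theory Defs
  imports "HOL-Analysis.Analysis"
begin

section \<open>Complex Hilbert spaces\<close>

text \<open>The real inner product inherited from \<^class>\<open>real_inner\<close> is the real part of the complex
  one, so the norm is the one induced by \<open>cinner\<close>. The form \<open>cinner\<close> is linear in
  its first argument and conjugate-linear in its second. The zero space is not excluded.\<close>

class complex_hilbert = real_inner + complete_space +
  fixes scaleC :: "complex \<Rightarrow> 'a \<Rightarrow> 'a" (infixr "*\<^sub>C" 75)
    and cinner :: "'a \<Rightarrow> 'a \<Rightarrow> complex"
  assumes scaleC_add_right: "c *\<^sub>C (x + y) = c *\<^sub>C x + c *\<^sub>C y"
    and scaleC_add_left: "(c + d) *\<^sub>C x = c *\<^sub>C x + d *\<^sub>C x"
    and scaleC_scaleC: "c *\<^sub>C (d *\<^sub>C x) = (c * d) *\<^sub>C x"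
    and scaleC_of_real: "complex_of_real r *\<^sub>C x = r *\<^sub>R x"
    and cinner_commute: "cinner x y = cnj (cinner y x)"
    and cinner_add_left: "cinner (x + y) z = cinner x z + cinner y z"
    and cinner_scaleC_left: "cinner (c *\<^sub>C x) y = c * cinner x y"
    and Re_cinner: "Re (cinner x y) = inner x y"
begin

subclass banach ..

end

lemma cinner_self: "cinner x x = complex_of_real ((norm (x :: 'h::complex_hilbert))\<^sup>2)"
proof -
  have "Im (cinner x x) = - Im (cinner x x)"
    using arg_cong[OF cinner_commute[of x x], of Im] by simp
  then show ?thesis
    by (simp add: complex_eq_iff Re_cinner power2_norm_eq_inner)
qed

lemma norm_scaleC: "norm (c *\<^sub>C x) = cmod c * norm (x :: 'h::complex_hilbert)"
proof -
  have "cinner (c *\<^sub>C x) (c *\<^sub>C x) = c * cnj (c * cinner x x)"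
    by (metis cinner_commute cinner_scaleC_left)
  also have "\<dots> = c * cnj c * cinner x x"
    by (simp add: cinner_self)
  also have "\<dots> = complex_of_real ((cmod c * norm x)\<^sup>2)"
    by (simp add: cinner_self complex_norm_square power_mult_distrib del: of_real_power)
  finally have "(norm (c *\<^sub>C x))\<^sup>2 = (cmod c * norm x)\<^sup>2"
    by (simp only: cinner_self of_real_eq_iff)
  then show ?thesis
    by (simp add: power2_eq_iff_nonneg)
qed

section \<open>Bounded operators\<close>

text \<open>The type \<open>'h \<Rightarrow>\<^sub>L 'h\<close> consists of the bounded real-linear maps, with the operator norm;
  \<open>bounded_ops\<close> is its subset \<open>B(H)\<close> of complex-linear ones.\<close>

definition bounded_ops :: "('h::complex_hilbert \<Rightarrow>\<^sub>L 'h) set" where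
  "bounded_ops = {a. \<forall>c \<xi>. blinfun_apply a (c *\<^sub>C \<xi>) = c *\<^sub>C blinfun_apply a \<xi>}"

definition scaleC_op :: "complex \<Rightarrow> ('h::complex_hilbert \<Rightarrow>\<^sub>L 'h) \<Rightarrow> ('h \<Rightarrow>\<^sub>L 'h)" where
  "scaleC_op c a = Blinfun (\<lambda>\<xi>. c *\<^sub>C blinfun_apply a \<xi>)"

lemma scaleC_op_apply: "blinfun_apply (scaleC_op c a) \<xi> = c *\<^sub>C blinfun_apply a \<xi>"
proof -
  have "bounded_linear (\<lambda>x::'a. c *\<^sub>C x)"
  proof (rule bounded_linear_intro[where K = "cmod c"])
    show "c *\<^sub>C (r *\<^sub>R x) = r *\<^sub>R (c *\<^sub>C x)" for r and x :: 'a
      by (metis scaleC_of_real scaleC_scaleC mult.commute)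
  qed (simp_all add: scaleC_add_right norm_scaleC mult.commute)
  then have "bounded_linear (\<lambda>x. c *\<^sub>C blinfun_apply a x)"
    by (rule bounded_linear_compose) (rule blinfun.bounded_linear_right)
  then show ?thesis
    by (simp add: scaleC_op_def bounded_linear_Blinfun_apply)
qed

definition adj :: "('h::complex_hilbert \<Rightarrow>\<^sub>L 'h) \<Rightarrow> ('h \<Rightarrow>\<^sub>L 'h)" where
  "adj a = (THE b. \<forall>\<xi> \<eta>. cinner (blinfun_apply a \<xi>) \<eta> = cinner \<xi> (blinfun_apply b \<eta>))"

definition unitary_op :: "('h::complex_hilbert \<Rightarrow>\<^sub>L 'h) \<Rightarrow> bool" where
  "unitary_op u \<longleftrightarrow> u \<in> bounded_ops \<and> adj u o\<^sub>L u = id_blinfun \<and> u o\<^sub>L adj u = id_blinfun"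

definition weak_operator_topology :: "('h::complex_hilbert \<Rightarrow>\<^sub>L 'h) topology" where
  "weak_operator_topology =
     pullback_topology UNIV (\<lambda>a (\<xi>, \<eta>). cinner (blinfun_apply a \<xi>) \<eta>) euclidean"

definition SOT :: "('h::complex_hilbert \<Rightarrow>\<^sub>L 'h) topology" where
  "SOT = subtopology strong_operator_topology bounded_ops"

definition WOT :: "('h::complex_hilbert \<Rightarrow>\<^sub>L 'h) topology" where
  "WOT = subtopology weak_operator_topology bounded_ops"

section \<open>Unbounded operators\<close>

text \<open>An unbounded operator is a partial map \<open>D\<close>, with domain of definition \<^term>\<open>dom D\<close>.\<close>

definition densely_defined_linear :: "('h::complex_hilbert \<rightharpoonup> 'h) \<Rightarrow> bool" where
  "densely_defined_linear D \<longleftrightarrow>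
     closure (dom D) = UNIV \<and>
     (\<forall>\<xi> \<xi>' \<zeta> \<zeta>'. D \<xi> = Some \<zeta> \<longrightarrow> D \<xi>' = Some \<zeta>' \<longrightarrow> D (\<xi> + \<xi>') = Some (\<zeta> + \<zeta>')) \<and>
     (\<forall>c \<xi> \<zeta>. D \<xi> = Some \<zeta> \<longrightarrow> D (c *\<^sub>C \<xi>) = Some (c *\<^sub>C \<zeta>))"

definition unbounded_adj :: "('h::complex_hilbert \<rightharpoonup> 'h) \<Rightarrow> ('h \<rightharpoonup> 'h)" where
  "unbounded_adj D \<eta> =
     (if \<exists>\<omega>. \<forall>\<xi>\<in>dom D. cinner (the (D \<xi>)) \<eta> = cinner \<xi> \<omega>
      then Some (THE \<omega>. \<forall>\<xi>\<in>dom D. cinner (the (D \<xi>)) \<eta> = cinner \<xi> \<omega>)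
      else None)"

definition self_adjoint :: "('h::complex_hilbert \<rightharpoonup> 'h) \<Rightarrow> bool" where
  "self_adjoint D \<longleftrightarrow> densely_defined_linear D \<and> unbounded_adj D = D"

definition unitary_group :: "(real \<Rightarrow> ('h::complex_hilbert \<Rightarrow>\<^sub>L 'h)) \<Rightarrow> bool" where
  "unitary_group U \<longleftrightarrow>
     (\<forall>t. unitary_op (U t)) \<and>
     U 0 = id_blinfun \<and>
     (\<forall>s t. U (s + t) = U s o\<^sub>L U t) \<and>
     (\<forall>\<xi>. continuous_on UNIV (\<lambda>t. blinfun_apply (U t) \<xi>))"

text \<open>For self-adjoint \<open>D\<close>, \<open>exp_i D t\<close> is \<open>e\<^sup>i\<^sup>t\<^sup>D\<close>: by Stone's theorem there is exactly one strongly
  continuous unitary group whose infinitesimal generator is \<open>iD\<close>. The equivalence below says that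
  the generator and \<open>iD\<close> agree, including their domains.\<close>

definition exp_i :: "('h::complex_hilbert \<rightharpoonup> 'h) \<Rightarrow> real \<Rightarrow> ('h \<Rightarrow>\<^sub>L 'h)" where
  "exp_i D = (THE U. unitary_group U \<and>
     (\<forall>\<xi> \<zeta>. D \<xi> = Some \<zeta> \<longleftrightarrow>
        ((\<lambda>t. blinfun_apply (U t) \<xi>) has_vector_derivative \<i> *\<^sub>C \<zeta>) (at 0)))"

definition alpha :: "('h::complex_hilbert \<rightharpoonup> 'h) \<Rightarrow> real \<Rightarrow> ('h \<Rightarrow>\<^sub>L 'h) \<Rightarrow> ('h \<Rightarrow>\<^sub>L 'h)" where
  "alpha D t a = exp_i D t o\<^sub>L a o\<^sub>L exp_i D (- t)"

section \<open>Weak and uniform derivatives\<close>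

definition has_weak_derivative ::
    "('h::complex_hilbert \<rightharpoonup> 'h) \<Rightarrow> ('h \<Rightarrow>\<^sub>L 'h) \<Rightarrow> ('h \<Rightarrow>\<^sub>L 'h) \<Rightarrow> bool" where
  "has_weak_derivative D a b \<longleftrightarrow> a \<in> bounded_ops \<and> b \<in> bounded_ops \<and>
     (\<forall>\<xi> \<eta>. ((\<lambda>t. cmod (cinner (blinfun_apply ((alpha D t a - a) /\<^sub>R t - b) \<xi>) \<eta>)) \<longlongrightarrow> 0) (at 0))"

definition has_uniform_derivative ::
    "('h::complex_hilbert \<rightharpoonup> 'h) \<Rightarrow> ('h \<Rightarrow>\<^sub>L 'h) \<Rightarrow> ('h \<Rightarrow>\<^sub>L 'h) \<Rightarrow> bool" where
  "has_uniform_derivative D a b \<longleftrightarrow> a \<in> bounded_ops \<and> b \<in> bounded_ops \<and>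
     ((\<lambda>t. norm ((alpha D t a - a) /\<^sub>R t - b)) \<longlongrightarrow> 0) (at 0)"

definition dom_w :: "('h::complex_hilbert \<rightharpoonup> 'h) \<Rightarrow> ('h \<Rightarrow>\<^sub>L 'h) set" where
  "dom_w D = {a. \<exists>b. has_weak_derivative D a b}"

definition delta_w :: "('h::complex_hilbert \<rightharpoonup> 'h) \<Rightarrow> ('h \<Rightarrow>\<^sub>L 'h) \<Rightarrow> ('h \<Rightarrow>\<^sub>L 'h)" where
  "delta_w D a = (THE b. has_weak_derivative D a b)"

definition dom_u :: "('h::complex_hilbert \<rightharpoonup> 'h) \<Rightarrow> ('h \<Rightarrow>\<^sub>L 'h) set" where
  "dom_u D = {a. \<exists>b. has_uniform_derivative D a b}"

definition delta_u :: "('h::complex_hilbert \<rightharpoonup> 'h) \<Rightarrow> ('h \<Rightarrow>\<^sub>L 'h) \<Rightarrow> ('h \<Rightarrow>\<^sub>L 'h)" where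
  "delta_u D a = (THE b. has_uniform_derivative D a b)"

section \<open>Algebras of operators and derivations\<close>

definition star_subalgebra :: "('h::complex_hilbert \<Rightarrow>\<^sub>L 'h) set \<Rightarrow> bool" where
  "star_subalgebra A \<longleftrightarrow> A \<subseteq> bounded_ops \<and> 0 \<in> A \<and>
     (\<forall>a\<in>A. \<forall>b\<in>A. a + b \<in> A) \<and>
     (\<forall>c. \<forall>a\<in>A. scaleC_op c a \<in> A) \<and>
     (\<forall>a\<in>A. \<forall>b\<in>A. a o\<^sub>L b \<in> A) \<and>
     (\<forall>a\<in>A. adj a \<in> A)"

definition star_derivation ::
    "('h::complex_hilbert \<Rightarrow>\<^sub>L 'h) set \<Rightarrow> (('h \<Rightarrow>\<^sub>L 'h) \<Rightarrow> ('h \<Rightarrow>\<^sub>L 'h)) \<Rightarrow> bool" where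
  "star_derivation A \<delta> \<longleftrightarrow>
     (\<forall>a\<in>A. \<delta> a \<in> bounded_ops) \<and>
     (\<forall>a\<in>A. \<forall>b\<in>A. \<delta> (a + b) = \<delta> a + \<delta> b) \<and>
     (\<forall>c. \<forall>a\<in>A. \<delta> (scaleC_op c a) = scaleC_op c (\<delta> a)) \<and>
     (\<forall>a\<in>A. \<forall>b\<in>A. \<delta> (a o\<^sub>L b) = (\<delta> a o\<^sub>L b) + (a o\<^sub>L \<delta> b)) \<and>
     (\<forall>a\<in>A. \<delta> (adj a) = adj (\<delta> a))"

text \<open>\<open>A\<close> carries the operations of \<open>B(H)\<close> but its own norm \<open>N\<close>; the involution of a Banach
  *-algebra is required to be isometric.\<close>

definition banach_star_algebra ::
    "('h::complex_hilbert \<Rightarrow>\<^sub>L 'h) set \<Rightarrow> (('h \<Rightarrow>\<^sub>L 'h) \<Rightarrow> real) \<Rightarrow> bool" where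
  "banach_star_algebra A N \<longleftrightarrow> star_subalgebra A \<and>
     (\<forall>a\<in>A. 0 \<le> N a \<and> (N a = 0 \<longleftrightarrow> a = 0)) \<and>
     (\<forall>a\<in>A. \<forall>b\<in>A. N (a + b) \<le> N a + N b) \<and>
     (\<forall>c. \<forall>a\<in>A. N (scaleC_op c a) = cmod c * N a) \<and>
     (\<forall>a\<in>A. \<forall>b\<in>A. N (a o\<^sub>L b) \<le> N a * N b) \<and>
     (\<forall>a\<in>A. N (adj a) = N a) \<and>
     Metric_space.mcomplete A (\<lambda>a b. N (a - b))"

end

theory Submission
  imports Defs
begin

text \<open>
  Everything rests on one description of weak differentiability, proved in
  \<open>has_weak_derivative_iff_form_commutator\<close>: bounded operators \<open>a\<close> and \<open>b\<close> satisfy \<open>\<delta>(a) = b\<close> if and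
  only if \<open>\<langle>b x, y\<rangle> = i (\<langle>a x, D y\<rangle> - \<langle>a D x, y\<rangle>)\<close> for all \<open>x\<close> and \<open>y\<close> in the domain of \<open>D\<close>, that is
  \<open>b = i [D, a]\<close> as a form. One direction differentiates \<open>\<langle>a e\<^sup>-\<^sup>i\<^sup>t\<^sup>D x, e\<^sup>-\<^sup>i\<^sup>t\<^sup>D y\<rangle>\<close> at 0. For the other, the
  form identity along the two orbits shows that this function has derivative \<open>\<langle>\<alpha>\<^sub>t(b) x, y\<rangle>\<close> at every
  \<open>t\<close>, whence \<open>\<parallel>\<alpha>\<^sub>t(a) - a\<parallel> \<le> \<bar>t\<bar> \<parallel>b\<parallel>\<close>; the difference quotients are thus bounded, and their convergence
  in the weak sense needs to be checked only on the dense domain of \<open>D\<close>.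

  The claims follow. For fixed \<open>x\<close> and \<open>y\<close> the identity is a weakly closed condition on \<open>(a, b)\<close>, so
  the graph of \<open>\<delta>\<close> is weakly closed; being norm closed as well, it makes the domain complete in the
  graph norm. As \<open>D\<close> is self-adjoint, the identity puts \<open>a x\<close> into the domain of \<open>D\<close> with
  \<open>D a x = a D x - i b x\<close>, and the Leibniz rule becomes that of a commutator; for adjoints one conjugates
  the identity. For density, let \<open>R = (1 + i l D)\<^sup>-\<^sup>1\<close> with real \<open>l \<noteq> 0\<close>. Since \<open>i l D R = 1 - R\<close> is bounded,
  \<open>R a R\<close> is weakly differentiable for every bounded \<open>a\<close>, with derivative \<open>(a R - R a) / l\<close>, and it
  converges strongly to \<open>a\<close> as \<open>l\<close> tends to 0.

  All this uses that \<open>exp_i D\<close>, which is given by a description, really is a strongly continuous unitary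
  group with generator \<open>i D\<close>. That is Stone's theorem, \<open>stone_group_generates\<close> together with
  \<open>generates_unique\<close>. The group is built from the bounded skew operators \<open>i D (1 + l\<^sup>2 D\<^sup>2)\<^sup>-\<^sup>1\<close>, which
  commute with each other and converge to \<open>i D\<close> on its domain. Their exponentials are isometric, and at
  time \<open>t\<close> two of them differ at \<open>x\<close> by at most \<open>\<bar>t\<bar>\<close> times the distance of the generators at \<open>x\<close>, so that
  they converge strongly. The resolvents needed here, like adjoints of bounded operators, come from
  orthogonal projections onto closed subspaces.
\<close>

section \<open>The complex inner product and orthogonal projections\<close>

lemma cinner_add_right: "cinner x (y + z) = cinner x y + cinner (x :: 'h::complex_hilbert) z"
  by (metis cinner_add_left cinner_commute complex_cnj_add)

lemma cinner_scaleC_right: "cinner x (c *\<^sub>C y) = cnj c * cinner (x :: 'h::complex_hilbert) y"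
  by (metis cinner_scaleC_left cinner_commute complex_cnj_mult)

lemma cinner_scaleR_left: "cinner (r *\<^sub>R x) y = r *\<^sub>R cinner (x :: 'h::complex_hilbert) y"
  by (metis cinner_scaleC_left scaleC_of_real scaleR_conv_of_real)

lemma cinner_scaleR_right: "cinner x (r *\<^sub>R y) = r *\<^sub>R cinner (x :: 'h::complex_hilbert) y"
  by (metis cinner_scaleC_right scaleC_of_real scaleR_conv_of_real complex_cnj_complex_of_real)

lemma cmod_cinner_le: "cmod (cinner x y) \<le> norm x * norm (y :: 'h::complex_hilbert)"
proof (cases "cinner x y = 0")
  case False
  define c where "c = cinner x y"
  have "(cmod c)\<^sup>2 = Re (cinner (cnj c *\<^sub>C x) y)"
    by (simp add: cinner_scaleC_left c_def cmod_power2) (simp add: power2_eq_square)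
  also have "\<dots> \<le> norm (cnj c *\<^sub>C x) * norm y"
    unfolding Re_cinner by (rule norm_cauchy_schwarz)
  finally have "cmod c * cmod c \<le> cmod c * (norm x * norm y)"
    by (simp add: norm_scaleC power2_eq_square mult.assoc)
  then show ?thesis
    using False by (simp add: c_def)
qed simp

lemma cmod_cinner_blinfun_le:
  "cmod (cinner (blinfun_apply a x) y) \<le> norm a * norm x * norm (y :: 'h::complex_hilbert)"
  by (rule order_trans[OF cmod_cinner_le mult_right_mono[OF norm_blinfun norm_ge_zero]])

lemma bounded_bilinear_cinner:
  "bounded_bilinear (cinner :: 'h::complex_hilbert \<Rightarrow> 'h \<Rightarrow> complex)"
proof
  show "\<exists>K. \<forall>a b. norm (cinner (a::'h) b) \<le> norm a * norm b * K"
    by (intro exI[of _ 1]) (simp add: cmod_cinner_le)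
qed (simp_all add: cinner_add_left cinner_add_right cinner_scaleR_left cinner_scaleR_right)

interpretation cinner: bounded_bilinear "cinner :: 'h::complex_hilbert \<Rightarrow> 'h \<Rightarrow> complex"
  by (rule bounded_bilinear_cinner)

lemma cinner_eq_Complex:
  "cinner x y = Complex (inner x y) (- inner (\<i> *\<^sub>C x) (y :: 'h::complex_hilbert))"
proof -
  have "inner (\<i> *\<^sub>C x) y = Re (\<i> * cinner x y)"
    by (simp only: Re_cinner[symmetric] cinner_scaleC_left)
  then show ?thesis
    by (simp add: complex_eq_iff Re_cinner)
qed

lemma scaleC_zero_left [simp]: "0 *\<^sub>C x = (0 :: 'h::complex_hilbert)"
  by (metis scaleC_of_real of_real_0 scaleR_zero_left)

lemma scaleC_zero_right [simp]: "c *\<^sub>C 0 = (0 :: 'h::complex_hilbert)"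
  by (metis norm_eq_zero norm_scaleC mult_zero_right)

lemma scaleC_one [simp]: "1 *\<^sub>C x = (x :: 'h::complex_hilbert)"
  by (metis scaleC_of_real of_real_1 scaleR_one)

lemma scaleC_minus_right: "c *\<^sub>C (- x) = - (c *\<^sub>C (x :: 'h::complex_hilbert))"
  by (metis add.right_inverse add_eq_0_iff scaleC_add_right scaleC_zero_right)

lemma scaleC_minus_left: "(- c) *\<^sub>C x = - (c *\<^sub>C (x :: 'h::complex_hilbert))"
  by (metis add.right_inverse add_eq_0_iff scaleC_add_left scaleC_zero_left)

lemma scaleC_diff_right: "c *\<^sub>C (x - y) = c *\<^sub>C x - c *\<^sub>C (y :: 'h::complex_hilbert)"
  by (metis diff_conv_add_uminus scaleC_add_right scaleC_minus_right)

lemma scaleC_scaleR: "c *\<^sub>C (r *\<^sub>R x) = r *\<^sub>R (c *\<^sub>C (x :: 'h::complex_hilbert))"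
  by (metis scaleC_of_real scaleC_scaleC mult.commute)

lemma bounded_linear_scaleC: "bounded_linear ((*\<^sub>C) c :: 'h::complex_hilbert \<Rightarrow> 'h)"
  by (rule bounded_linear_intro[where K = "cmod c"])
     (simp_all add: scaleC_add_right scaleC_scaleR norm_scaleC mult.commute)

lemma cinner_eqI:
  assumes "closure X = UNIV" and "\<And>x. x \<in> X \<Longrightarrow> cinner x y = cinner x (z :: 'h::complex_hilbert)"
  shows "y = z"
proof -
  have "closure X \<subseteq> {x. cinner x y = cinner x z}"
  proof (rule closure_minimal)
    show "closed {x. cinner x y = cinner x z}"
      by (intro closed_Collect_eq linear_continuous_on cinner.bounded_linear_left)
  qed (use assms(2) in auto)
  then have "cinner (y - z) y = cinner (y - z) z"
    using assms(1) by auto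
  then have "cinner (y - z) (y - z) = 0"
    by (simp add: cinner.diff_right)
  then show ?thesis
    by (simp add: cinner_self)
qed

lemma cinner_ext:
  assumes "\<And>x. cinner x y = cinner x (z :: 'h::complex_hilbert)"
  shows "y = z"
  using cinner_eqI[of UNIV y z] assms by simp

text \<open>A sequence in the subspace that minimises the distance to \<open>x\<close> is Cauchy by the parallelogram
  law, because midpoints stay in the subspace and so cannot be closer than the infimum.\<close>

lemma orthogonal_projection_exists:
  fixes S :: "'a::{real_inner, complete_space} set"
  assumes S: "subspace S" and cl: "closed S"
  obtains p where "p \<in> S" "\<And>s. s \<in> S \<Longrightarrow> inner s (x - p) = 0"
proof -
  define d where "d = infdist x S"
  have ne: "S \<noteq> {}"
    using subspace_0[OF S] by auto
  have d_le: "d \<le> norm (x - s)" if "s \<in> S" for s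
    using infdist_le[OF that, of x] by (simp add: d_def dist_norm)
  have d0: "0 \<le> d"
    by (simp add: d_def infdist_nonneg)
  have "\<exists>s\<in>S. norm (x - s) < d + inverse (real (Suc n))" for n
  proof -
    have "(INF a\<in>S. dist x a) < d + inverse (real (Suc n))"
      using ne by (simp add: d_def infdist_notempty)
    then show ?thesis
      using ne by (subst (asm) cINF_less_iff) (auto simp: dist_norm bdd_below_def intro: exI[of _ 0])
  qed
  then obtain s where sS: "s n \<in> S" and sd: "norm (x - s n) < d + inverse (real (Suc n))" for n
    by metis
  have lim_d: "(\<lambda>n. norm (x - s n)) \<longlonglongrightarrow> d"
  proof (rule tendsto_sandwich[OF _ _ tendsto_const])
    show "(\<lambda>n. d + inverse (real (Suc n))) \<longlonglongrightarrow> d"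
      using tendsto_add[OF tendsto_const LIMSEQ_inverse_real_of_nat] by simp
  qed (use d_le sS less_imp_le[OF sd] in \<open>simp_all del: of_nat_Suc\<close>)
  have par: "(norm (s m - s n))\<^sup>2 \<le> 2 * (norm (x - s m))\<^sup>2 + 2 * (norm (x - s n))\<^sup>2 - 4 * d\<^sup>2" for m n
  proof -
    have "(1/2) *\<^sub>R (s m + s n) \<in> S"
      using S sS by (intro subspace_scale subspace_add)
    then have "d\<^sup>2 \<le> (norm (x - (1/2) *\<^sub>R (s m + s n)))\<^sup>2"
      using d_le d0 power_mono by blast
    then have "4 * d\<^sup>2 \<le> (norm (2 *\<^sub>R (x - (1/2) *\<^sub>R (s m + s n))))\<^sup>2"
      by (simp add: power_mult_distrib)
    also have "2 *\<^sub>R (x - (1/2) *\<^sub>R (s m + s n)) = (x - s m) + (x - s n)"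
      by (simp add: algebra_simps scaleR_2)
    finally have "4 * d\<^sup>2 \<le> (norm ((x - s m) + (x - s n)))\<^sup>2" .
    moreover have "s m - s n = (x - s n) - (x - s m)"
      by simp
    moreover have "(norm (a + b))\<^sup>2 + (norm (b - a))\<^sup>2 = 2 * (norm a)\<^sup>2 + 2 * (norm b)\<^sup>2" for a b :: 'a
      by (simp add: power2_norm_eq_inner inner_simps inner_commute)
    ultimately show ?thesis
      by (smt (verit))
  qed
  have "Cauchy s"
  proof (rule CauchyI)
    fix e :: real assume e: "0 < e"
    have "(\<lambda>n. (norm (x - s n))\<^sup>2) \<longlonglongrightarrow> d\<^sup>2"
      by (intro tendsto_intros lim_d)
    then have "eventually (\<lambda>n. (norm (x - s n))\<^sup>2 < d\<^sup>2 + e\<^sup>2 / 4) sequentially"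
      using e by (intro order_tendstoD) auto
    then obtain N where N: "\<And>n. N \<le> n \<Longrightarrow> (norm (x - s n))\<^sup>2 < d\<^sup>2 + e\<^sup>2 / 4"
      by (auto simp: eventually_sequentially)
    have "norm (s m - s n) < e" if "N \<le> m" "N \<le> n" for m n
    proof (rule power2_less_imp_less)
      show "(norm (s m - s n))\<^sup>2 < e\<^sup>2"
        using par[of m n] N[OF that(1)] N[OF that(2)] by linarith
    qed (use e in simp)
    then show "\<exists>M. \<forall>m\<ge>M. \<forall>n\<ge>M. norm (s m - s n) < e"
      by blast
  qed
  then obtain p where p: "s \<longlonglongrightarrow> p"
    using Cauchy_convergent_iff convergent_def by blast
  have pS: "p \<in> S"
    using closed_sequentially[OF cl _ p] sS by auto
  have pd: "norm (x - p) = d"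
    using LIMSEQ_unique[OF lim_d] tendsto_norm[OF tendsto_diff[OF tendsto_const p]] by metis
  have "inner z (x - p) = 0" if z: "z \<in> S" for z
  proof (cases "z = 0")
    case False
    \<comment> \<open>The multiple \<open>t z\<close> that would bring \<open>p\<close> closest to \<open>x\<close> along \<open>z\<close>.\<close>
    define t where "t = inner z (x - p) / (norm z)\<^sup>2"
    have "p + t *\<^sub>R z \<in> S"
      using S pS z by (intro subspace_scale subspace_add)
    then have "(norm (x - p))\<^sup>2 \<le> (norm (x - (p + t *\<^sub>R z)))\<^sup>2"
      using d_le pd by (intro power_mono) auto
    also have "\<dots> = (norm (x - p))\<^sup>2 - 2 * t * inner z (x - p) + t\<^sup>2 * (norm z)\<^sup>2"
      unfolding power2_norm_eq_inner by (simp add: inner_simps inner_commute power2_eq_square algebra_simps)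
    also have "\<dots> = (norm (x - p))\<^sup>2 - (inner z (x - p))\<^sup>2 / (norm z)\<^sup>2"
      using False by (simp add: t_def power2_eq_square field_simps)
    finally have "(inner z (x - p))\<^sup>2 / (norm z)\<^sup>2 \<le> 0"
      by simp
    then show ?thesis
      using False by (simp add: divide_le_0_iff)
  qed simp
  with pS show ?thesis
    using that by blast
qed

lemma orthogonal_projection_exists_complex:
  fixes S :: "'h::complex_hilbert set"
  assumes "closed S" and zero: "0 \<in> S" and add: "\<And>x y. x \<in> S \<Longrightarrow> y \<in> S \<Longrightarrow> x + y \<in> S"
    and scale: "\<And>c x. x \<in> S \<Longrightarrow> c *\<^sub>C x \<in> S"
  obtains p where "p \<in> S" "\<And>s. s \<in> S \<Longrightarrow> cinner s (x - p) = 0"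
proof -
  have "subspace S"
    using zero add scale unfolding subspace_def by (metis scaleC_of_real)
  then obtain p where p: "p \<in> S" "\<And>s. s \<in> S \<Longrightarrow> inner s (x - p) = 0"
    using orthogonal_projection_exists[OF _ assms(1)] by metis
  then have "cinner s (x - p) = 0" if "s \<in> S" for s
    using that scale by (simp add: cinner_eq_Complex Complex_eq_0)
  with p(1) show ?thesis
    using that by blast
qed

text \<open>A vector orthogonal to the kernel of \<open>f\<close> represents \<open>f\<close> up to a scalar, because
  \<open>f(q) x - f(x) q\<close> is in the kernel.\<close>

lemma riesz_representation:
  fixes f :: "'h::complex_hilbert \<Rightarrow> complex"
  assumes bl: "bounded_linear f" and hom: "\<And>c x. f (c *\<^sub>C x) = c * f x"
  obtains y where "\<And>x. f x = cinner x y"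
proof (cases "\<forall>x. f x = 0")
  case True
  then show ?thesis
    using that[of 0] by (simp add: cinner.zero_right)
next
  case False
  interpret bounded_linear f by (rule bl)
  from False obtain x0 where x0: "f x0 \<noteq> 0" by blast
  have "closed {x. f x = 0}"
    by (intro closed_Collect_eq linear_continuous_on bl continuous_on_const)
  then have "\<exists>p. f p = 0 \<and> (\<forall>s. f s = 0 \<longrightarrow> cinner s (x0 - p) = 0)"
    by (rule orthogonal_projection_exists_complex[of _ x0]) (auto simp: add hom zero)
  then obtain p where p: "f p = 0" "\<And>s. f s = 0 \<Longrightarrow> cinner s (x0 - p) = 0"
    by blast
  define q where "q = x0 - p"
  have fq: "f q \<noteq> 0"
    using x0 p(1) by (simp add: q_def diff)
  then have q0: "q \<noteq> 0"
    using zero by metis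
  have "f x = cinner x ((cnj (f q) / cinner q q) *\<^sub>C q)" for x
  proof -
    have "f (f q *\<^sub>C x - f x *\<^sub>C q) = 0"
      by (simp add: diff hom)
    then have "cinner (f q *\<^sub>C x - f x *\<^sub>C q) q = 0"
      unfolding q_def by (rule p(2))
    then have "f q * cinner x q = f x * cinner q q"
      by (simp add: cinner.diff_left cinner_scaleC_left)
    then show ?thesis
      using q0 by (simp add: cinner_scaleC_right cinner_self field_simps)
  qed
  then show ?thesis
    using that by blast
qed

section \<open>Adjoints of bounded operators\<close>

lemma bounded_ops_scaleC: "a \<in> bounded_ops \<Longrightarrow> blinfun_apply a (c *\<^sub>C x) = c *\<^sub>C blinfun_apply a x"
  by (simp add: bounded_ops_def)

lemma blinfun_compose_in_bounded_ops:
  "a \<in> bounded_ops \<Longrightarrow> b \<in> bounded_ops \<Longrightarrow> a o\<^sub>L b \<in> bounded_ops"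
  by (simp add: bounded_ops_def)

lemma add_in_bounded_ops: "a \<in> bounded_ops \<Longrightarrow> b \<in> bounded_ops \<Longrightarrow> a + b \<in> bounded_ops"
  by (simp add: bounded_ops_def blinfun.add_left scaleC_add_right)

lemma diff_in_bounded_ops: "a \<in> bounded_ops \<Longrightarrow> b \<in> bounded_ops \<Longrightarrow> a - b \<in> bounded_ops"
  by (simp add: bounded_ops_def blinfun.diff_left scaleC_diff_right)

lemma scaleR_in_bounded_ops: "a \<in> bounded_ops \<Longrightarrow> r *\<^sub>R a \<in> bounded_ops"
  by (simp add: bounded_ops_def blinfun.scaleR_left scaleC_scaleR)

lemma scaleC_op_in_bounded_ops: "a \<in> bounded_ops \<Longrightarrow> scaleC_op c a \<in> bounded_ops"
  by (simp add: bounded_ops_def scaleC_op_apply scaleC_scaleC mult.commute)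

lemma norm_scaleC_op: "norm (scaleC_op c a) = cmod c * norm a"
proof (rule antisym)
  have le: "norm (scaleC_op c a) \<le> cmod c * norm a" for c and a :: "'a \<Rightarrow>\<^sub>L 'a"
    by (rule norm_blinfun_bound)
       (simp_all add: scaleC_op_apply norm_scaleC mult.assoc mult_left_mono norm_blinfun)
  show "norm (scaleC_op c a) \<le> cmod c * norm a"
    by (rule le)
  show "cmod c * norm a \<le> norm (scaleC_op c a)"
  proof (cases "c = 0")
    case False
    have "a = scaleC_op (inverse c) (scaleC_op c a)"
      using False by (intro blinfun_eqI) (simp add: scaleC_op_apply scaleC_scaleC)
    then have "norm a \<le> cmod (inverse c) * norm (scaleC_op c a)"
      using le by metis
    then show ?thesis
      using False by (simp add: norm_inverse field_simps norm_divide)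
  qed simp
qed

lemma cinner_adj:
  assumes a: "a \<in> bounded_ops"
  shows "cinner (blinfun_apply a \<xi>) \<eta> = cinner \<xi> (blinfun_apply (adj a) \<eta>)"
proof -
  have "\<exists>z. \<forall>\<xi>. cinner (blinfun_apply a \<xi>) \<eta> = cinner \<xi> z" for \<eta>
  proof -
    have "bounded_linear (\<lambda>\<xi>. cinner (blinfun_apply a \<xi>) \<eta>)"
      using bounded_linear_compose[OF cinner.bounded_linear_left blinfun.bounded_linear_right] .
    then show ?thesis
      by (rule riesz_representation) (auto simp: bounded_ops_scaleC[OF a] cinner_scaleC_left)
  qed
  then obtain g where g: "cinner (blinfun_apply a \<xi>) \<eta> = cinner \<xi> (g \<eta>)" for \<xi> \<eta>
    by metis
  have "bounded_linear g"
  proof (rule bounded_linear_intro[where K = "norm a"])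
    show "g (x + y) = g x + g y" for x y
      by (rule cinner_ext) (simp add: g[symmetric] cinner_add_right)
    show "g (r *\<^sub>R x) = r *\<^sub>R g x" for r x
      by (rule cinner_ext) (simp add: g[symmetric] cinner_scaleR_right)
    show "norm (g x) \<le> norm x * norm a" for x
    proof (cases "g x = 0")
      case False
      have "norm (g x) * norm (g x) = cmod (cinner (g x) (g x))"
        by (simp add: cinner_self norm_power power2_eq_square norm_mult)
      also have "\<dots> = cmod (cinner (blinfun_apply a (g x)) x)"
        by (simp add: g)
      also have "\<dots> \<le> norm a * norm (g x) * norm x"
        by (rule cmod_cinner_blinfun_le)
      finally have "norm (g x) * norm (g x) \<le> norm (g x) * (norm x * norm a)"
        by (simp add: mult.commute mult.left_commute)
      then show ?thesis
        using False by simp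
    qed simp
  qed
  then have "\<forall>\<xi> \<eta>. cinner (blinfun_apply a \<xi>) \<eta> = cinner \<xi> (blinfun_apply (Blinfun g) \<eta>)"
    by (simp add: bounded_linear_Blinfun_apply g)
  moreover have "b = Blinfun g"
    if "\<forall>\<xi> \<eta>. cinner (blinfun_apply a \<xi>) \<eta> = cinner \<xi> (blinfun_apply b \<eta>)" for b
    using calculation that by (intro blinfun_eqI cinner_ext) metis
  ultimately have "adj a = Blinfun g"
    unfolding adj_def by (rule the_equality)
  then show ?thesis
    using \<open>bounded_linear g\<close> by (simp add: bounded_linear_Blinfun_apply g)
qed

lemma adj_unique:
  assumes "a \<in> bounded_ops"
    and "\<And>\<xi> \<eta>. cinner (blinfun_apply a \<xi>) \<eta> = cinner \<xi> (blinfun_apply b \<eta>)"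
  shows "adj a = b"
proof (rule blinfun_eqI)
  show "blinfun_apply (adj a) \<eta> = blinfun_apply b \<eta>" for \<eta>
  proof (rule cinner_ext)
    show "cinner \<xi> (blinfun_apply (adj a) \<eta>) = cinner \<xi> (blinfun_apply b \<eta>)" for \<xi>
      using cinner_adj[OF assms(1), of \<xi> \<eta>] assms(2)[of \<xi> \<eta>] by simp
  qed
qed

lemma adj_in_bounded_ops:
  assumes a: "a \<in> bounded_ops"
  shows "adj a \<in> bounded_ops"
proof -
  have "blinfun_apply (adj a) (c *\<^sub>C \<xi>) = c *\<^sub>C blinfun_apply (adj a) \<xi>" for c \<xi>
    by (rule cinner_ext) (simp add: cinner_adj[OF a, symmetric] cinner_scaleC_right)
  then show ?thesis
    by (simp add: bounded_ops_def)
qed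

lemma cinner_adj_left:
  assumes "a \<in> bounded_ops"
  shows "cinner (blinfun_apply (adj a) \<xi>) \<eta> = cinner \<xi> (blinfun_apply a \<eta>)"
  using cinner_adj[OF assms, of \<eta> \<xi>] cinner_commute[of "blinfun_apply (adj a) \<xi>" \<eta>]
    cinner_commute[of \<xi> "blinfun_apply a \<eta>"] by simp

lemma adj_adj:
  assumes "a \<in> bounded_ops"
  shows "adj (adj a) = a"
  by (intro adj_unique adj_in_bounded_ops assms cinner_adj_left)

lemma norm_adj:
  assumes a: "a \<in> bounded_ops"
  shows "norm (adj a) = norm a"
proof -
  have le: "norm (adj b) \<le> norm b" if b: "b \<in> bounded_ops" for b :: "'a \<Rightarrow>\<^sub>L 'a"
  proof (rule norm_blinfun_bound)
    fix x
    let ?y = "blinfun_apply (adj b) x"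
    have "(norm ?y)\<^sup>2 = cmod (cinner ?y ?y)"
      by (simp add: cinner_self norm_power)
    also have "\<dots> = cmod (cinner (blinfun_apply b ?y) x)"
      by (simp add: cinner_adj[OF b])
    also have "\<dots> \<le> (norm b * norm ?y) * norm x"
      by (rule cmod_cinner_blinfun_le)
    finally have "norm ?y * norm ?y \<le> (norm b * norm x) * norm ?y"
      by (simp add: power2_eq_square mult_ac)
    then show "norm ?y \<le> norm b * norm x"
      by (cases "norm ?y = 0") (auto simp: mult_le_cancel_right)
  qed simp
  show ?thesis
    using le[OF a] le[OF adj_in_bounded_ops[OF a]] adj_adj[OF a] by simp
qed

text \<open>Polarisation recovers the real inner product from the norm, and multiplication by \<open>\<i>\<close>
  recovers the complex one.\<close>

lemma isometry_preserves_cinner: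
  assumes u: "u \<in> bounded_ops" and iso: "\<And>x. norm (blinfun_apply u x) = norm x"
  shows "cinner (blinfun_apply u x) (blinfun_apply u y) = cinner x y"
proof -
  have re: "inner (blinfun_apply u x) (blinfun_apply u y) = inner x y" for x y
    by (simp add: dot_norm blinfun.add_right[symmetric] iso)
  show ?thesis
    unfolding cinner_eq_Complex by (simp add: re bounded_ops_scaleC[OF u, symmetric])
qed

section \<open>Exponentials of bounded skew operators\<close>

primrec blinfun_power :: "('a::real_normed_vector \<Rightarrow>\<^sub>L 'a) \<Rightarrow> nat \<Rightarrow> ('a \<Rightarrow>\<^sub>L 'a)" where
  "blinfun_power A 0 = id_blinfun"
| "blinfun_power A (Suc n) = A o\<^sub>L blinfun_power A n"

lemma norm_blinfun_power_le: "norm (blinfun_power A n) \<le> norm A ^ n"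
proof (induction n)
  case (Suc n)
  have "norm (blinfun_power A (Suc n)) \<le> norm A * norm (blinfun_power A n)"
    by (simp add: norm_blinfun_compose)
  also have "\<dots> \<le> norm A * norm A ^ n"
    by (intro mult_left_mono Suc) simp
  finally show ?case by simp
qed (simp add: norm_blinfun_id_le)

text \<open>The exponential \<open>e\<^sup>t\<^sup>A\<close>, with powers taken for composition.\<close>

definition op_exp :: "('a::banach \<Rightarrow>\<^sub>L 'a) \<Rightarrow> real \<Rightarrow> ('a \<Rightarrow>\<^sub>L 'a)" where
  "op_exp A t = (\<Sum>k. (t ^ k / fact k) *\<^sub>R blinfun_power A k)"

lemma norm_op_exp_term_le:
  assumes "\<bar>t\<bar> \<le> r"
  shows "norm ((t ^ k / fact k) *\<^sub>R blinfun_power A k) \<le> (r * norm A) ^ k /\<^sub>R fact k"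
proof -
  have "\<bar>t\<bar> ^ k * norm (blinfun_power A k) \<le> r ^ k * norm A ^ k"
    using assms by (intro mult_mono power_mono norm_blinfun_power_le) auto
  then show ?thesis
    by (simp add: power_abs power_mult_distrib divide_simps)
qed

lemma summable_op_exp:
  fixes A :: "'a::banach \<Rightarrow>\<^sub>L 'a"
  shows "summable (\<lambda>k. (t ^ k / fact k) *\<^sub>R blinfun_power A k)"
  by (rule summable_comparison_test'[OF summable_exp_generic[of "\<bar>t\<bar> * norm A"]])
     (rule norm_op_exp_term_le, simp)

lemma op_exp_0: "op_exp A 0 = id_blinfun"
  using suminf_finite[of "{0}" "\<lambda>k. (0 ^ k / fact k) *\<^sub>R blinfun_power A k"]
  by (simp add: op_exp_def power_0_left)

text \<open>Termwise differentiation shifts the series by one and produces a factor \<open>A\<close>; on bounded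
  intervals the differentiated series is dominated by a scalar exponential series.\<close>

lemma op_exp_has_vector_derivative:
  "(op_exp A has_vector_derivative (A o\<^sub>L op_exp A t)) (at t)"
proof -
  define f where "f k t = (t ^ k / fact k) *\<^sub>R blinfun_power A k" for k t
  define df where "df k t = (real k * t ^ (k - 1) / fact k) *\<^sub>R blinfun_power A k" for k t
  have df_Suc: "df (Suc k) t = A o\<^sub>L f k t" for k t
    by (simp add: df_def f_def bounded_bilinear.scaleR_right[OF bounded_bilinear_blinfun_compose]
        del: of_nat_Suc)
  have f_deriv: "(f k has_derivative (\<lambda>h. h *\<^sub>R df k x)) (at x within S)" for k x S
    unfolding f_def df_def
    by (auto intro!: derivative_eq_intros simp: algebra_simps)
  define r where "r = \<bar>t\<bar> + 1"
  have r: "0 < r"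
    using abs_ge_zero[of t] unfolding r_def by linarith
  let ?S = "{-r<..<r}"
  define M where "M k = (case k of 0 \<Rightarrow> 0 | Suc j \<Rightarrow> norm A * ((r * norm A) ^ j /\<^sub>R fact j))" for k
  have le_M: "norm (df k x) \<le> M k" if "x \<in> ?S" for k x
  proof (cases k)
    case (Suc j)
    have "norm (df k x) \<le> norm A * norm (f j x)"
      by (simp only: Suc df_Suc norm_blinfun_compose)
    also have "\<dots> \<le> norm A * ((r * norm A) ^ j /\<^sub>R fact j)"
      using that unfolding f_def by (intro mult_left_mono norm_op_exp_term_le) auto
    finally show ?thesis
      by (simp add: M_def Suc)
  qed (simp add: M_def df_def)
  have "summable (\<lambda>j. M (Suc j))"
    using summable_mult[OF summable_exp_generic, of "norm A" "r * norm A"] by (simp add: M_def)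
  then have "summable M"
    by (simp only: summable_Suc_iff)
  then have unif: "uniform_limit ?S (\<lambda>n x. \<Sum>k<n. df k x) (\<lambda>x. \<Sum>k. df k x) sequentially"
    using le_M by (intro Weierstrass_m_test)
  have suminf_df: "(\<Sum>k. df k x) = A o\<^sub>L op_exp A x" if "x \<in> ?S" for x
  proof -
    have "summable (\<lambda>k. df k x)"
      by (rule summable_comparison_test'[OF \<open>summable M\<close>]) (rule le_M[OF that])
    then have "(\<Sum>k. df k x) = (\<Sum>k. df (Suc k) x)"
      using suminf_split_head[of "\<lambda>k. df k x"] by (simp add: df_def)
    also have "\<dots> = A o\<^sub>L op_exp A x"
      unfolding df_Suc op_exp_def f_def
      by (rule bounded_linear.suminf[symmetric, OF bounded_bilinear.bounded_linear_right
            [OF bounded_bilinear_blinfun_compose] summable_op_exp])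
    finally show ?thesis .
  qed
  have "\<exists>g. \<forall>x\<in>?S. (\<lambda>k. f k x) sums g x \<and>
          (g has_derivative (\<lambda>h. h *\<^sub>R (A o\<^sub>L op_exp A x))) (at x within ?S)"
  proof (rule has_derivative_series[OF _ f_deriv])
    fix e :: real assume "0 < e"
    then have "\<forall>\<^sub>F n in sequentially. \<forall>x\<in>?S. dist (\<Sum>k<n. df k x) (\<Sum>k. df k x) < e"
      using unif by (simp add: uniform_limit_iff)
    then show "\<forall>\<^sub>F n in sequentially. \<forall>x\<in>?S. \<forall>h.
        norm ((\<Sum>k<n. h *\<^sub>R df k x) - h *\<^sub>R (A o\<^sub>L op_exp A x)) \<le> e * norm h"
    proof eventually_elim
      case (elim n)
      show ?case
      proof (intro ballI allI)
        fix x h assume x: "x \<in> ?S"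
        have "norm ((\<Sum>k<n. h *\<^sub>R df k x) - h *\<^sub>R (A o\<^sub>L op_exp A x))
            = \<bar>h\<bar> * dist (\<Sum>k<n. df k x) (\<Sum>k. df k x)"
          by (simp only: scaleR_sum_right[symmetric] scaleR_diff_right[symmetric] norm_scaleR
              dist_norm suminf_df[OF x])
        also have "\<dots> \<le> \<bar>h\<bar> * e"
          using elim x by (intro mult_left_mono) (auto intro: less_imp_le)
        finally show "norm ((\<Sum>k<n. h *\<^sub>R df k x) - h *\<^sub>R (A o\<^sub>L op_exp A x)) \<le> e * norm h"
          by (simp add: mult.commute)
      qed
    qed
  next
    show "0 \<in> ?S"
      using r by simp
    show "(\<lambda>k. f k 0) sums op_exp A 0"
      unfolding op_exp_def f_def by (intro summable_sums summable_op_exp)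
  qed (simp add: convex_real_interval)
  then obtain g where g: "\<And>x. x \<in> ?S \<Longrightarrow> (\<lambda>k. f k x) sums g x"
      "\<And>x. x \<in> ?S \<Longrightarrow> (g has_derivative (\<lambda>h. h *\<^sub>R (A o\<^sub>L op_exp A x))) (at x within ?S)"
    by blast
  have "t \<in> ?S"
    by (auto simp: r_def)
  then have "(op_exp A has_derivative (\<lambda>h. h *\<^sub>R (A o\<^sub>L op_exp A t))) (at t within ?S)"
    by (rule has_derivative_transform[rotated 2, OF g(2)])
       (use g(1) \<open>t \<in> ?S\<close> in \<open>auto simp: op_exp_def f_def sums_iff\<close>)
  then show ?thesis
    using at_within_open[OF \<open>t \<in> ?S\<close>] by (simp add: has_vector_derivative_def)
qed

lemma op_exp_apply_has_vector_derivative: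
  "((\<lambda>t. blinfun_apply (op_exp A t) x) has_vector_derivative
     blinfun_apply A (blinfun_apply (op_exp A t) x)) (at t within S)"
  using bounded_linear.has_vector_derivative[OF blinfun.bounded_linear_left[of x]
      has_vector_derivative_at_within[OF op_exp_has_vector_derivative[of A t]], of S]
  by simp

text \<open>The derivative of \<open>\<parallel>u\<parallel>\<^sup>2\<close> is \<open>2 \<langle>u', u\<rangle>\<close>. Applied to differences of solutions, this is the
  uniqueness theorem for the evolution equations of skew operators, bounded or not.\<close>

lemma norm_constant_of_orthogonal_derivative:
  fixes u :: "real \<Rightarrow> 'a::real_inner"
  assumes deriv: "\<And>t. (u has_vector_derivative u' t) (at t)" and orth: "\<And>t. inner (u' t) (u t) = 0"
  shows "norm (u t) = norm (u s)"
proof -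
  have "((\<lambda>t. inner (u t) (u t)) has_real_derivative 0) (at t)" for t
    using bounded_bilinear.has_vector_derivative[OF bounded_bilinear_inner deriv deriv, of t] orth[of t]
    by (simp add: has_real_derivative_iff_has_vector_derivative inner_commute)
  then have "inner (u t) (u t) = inner (u s) (u s)"
    by (intro DERIV_isconst_all) blast
  then show ?thesis
    by (simp add: norm_eq_sqrt_inner)
qed

lemma norm_increment_le:
  fixes f :: "real \<Rightarrow> 'a::real_normed_vector"
  assumes deriv: "\<And>t. (f has_vector_derivative f' t) (at t)" and le: "\<And>t. norm (f' t) \<le> B"
  shows "norm (f t - f s) \<le> B * \<bar>t - s\<bar>"
proof -
  have "onorm (\<lambda>h. h *\<^sub>R f' x) \<le> B" for x
    using le[of x] by (intro onorm_le) (simp add: mult.commute[of B] mult_left_mono)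
  then have "norm (f t - f s) \<le> B * norm (t - s)"
    using deriv by (intro differentiable_bound[of UNIV f "\<lambda>x h. h *\<^sub>R f' x"])
      (auto simp: has_vector_derivative_def)
  then show ?thesis by simp
qed

context
  fixes A :: "'a::{real_inner, banach} \<Rightarrow>\<^sub>L 'a"
  assumes skew: "\<And>x. inner (blinfun_apply A x) x = 0"
begin

lemma norm_op_exp_skew: "norm (blinfun_apply (op_exp A t) x) = norm x"
  using norm_constant_of_orthogonal_derivative[OF op_exp_apply_has_vector_derivative skew, of t x 0]
  by (simp add: op_exp_0)

text \<open>Here and for the group law, the two sides solve the same evolution equation with the same
  initial value.\<close>

lemma op_exp_skew_commute:
  assumes "C o\<^sub>L A = A o\<^sub>L C"
  shows "C o\<^sub>L op_exp A t = op_exp A t o\<^sub>L C"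
proof (rule blinfun_eqI)
  fix x
  let ?u = "\<lambda>t. blinfun_apply C (blinfun_apply (op_exp A t) x)
               - blinfun_apply (op_exp A t) (blinfun_apply C x)"
  have comm: "blinfun_apply C (blinfun_apply A y) = blinfun_apply A (blinfun_apply C y)" for y
    using arg_cong[OF assms, of "\<lambda>F. blinfun_apply F y"] by simp
  have "(?u has_vector_derivative blinfun_apply A (?u t)) (at t)" for t
    unfolding blinfun.diff_right comm[symmetric]
    by (intro has_vector_derivative_diff op_exp_apply_has_vector_derivative
        bounded_linear.has_vector_derivative[OF blinfun.bounded_linear_right])
  then have "norm (?u t) = norm (?u 0)"
    by (rule norm_constant_of_orthogonal_derivative) (rule skew)
  then show "blinfun_apply (C o\<^sub>L op_exp A t) x = blinfun_apply (op_exp A t o\<^sub>L C) x"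
    by (simp add: op_exp_0)
qed

lemma op_exp_skew_add: "op_exp A (s + t) = op_exp A s o\<^sub>L op_exp A t"
proof (rule blinfun_eqI)
  fix x
  let ?u = "\<lambda>s. blinfun_apply (op_exp A (s + t)) x
               - blinfun_apply (op_exp A s) (blinfun_apply (op_exp A t) x)"
  have shift: "((\<lambda>s. blinfun_apply (op_exp A (s + t)) x) has_vector_derivative
      blinfun_apply A (blinfun_apply (op_exp A (s + t)) x)) (at s)" for s
    using vector_diff_chain_at[of "\<lambda>s. s + t" 1 s, OF _ op_exp_apply_has_vector_derivative]
    by (simp add: o_def has_vector_derivative_add_const)
  have "(?u has_vector_derivative blinfun_apply A (?u s)) (at s)" for s
    unfolding blinfun.diff_right
    by (intro has_vector_derivative_diff op_exp_apply_has_vector_derivative shift)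
  then have "norm (?u s) = norm (?u 0)"
    by (rule norm_constant_of_orthogonal_derivative) (rule skew)
  then show "blinfun_apply (op_exp A (s + t)) x = blinfun_apply (op_exp A s o\<^sub>L op_exp A t) x"
    by (simp add: op_exp_0)
qed

end

text \<open>The path \<open>e\<^sup>-\<^sup>s\<^sup>B e\<^sup>s\<^sup>A x\<close> starts at \<open>x\<close>, and since the operators commute its speed is the
  constant \<open>\<parallel>A x - B x\<parallel>\<close>.\<close>

lemma op_exp_skew_difference:
  fixes A B :: "'a::{real_inner, banach} \<Rightarrow>\<^sub>L 'a"
  assumes A: "\<And>x. inner (blinfun_apply A x) x = 0" and B: "\<And>x. inner (blinfun_apply B x) x = 0"
    and comm: "A o\<^sub>L B = B o\<^sub>L A"
  shows "norm (blinfun_apply (op_exp A t) x - blinfun_apply (op_exp B t) x)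
    \<le> norm (blinfun_apply A x - blinfun_apply B x) * \<bar>t\<bar>"
proof -
  let ?f = "\<lambda>s. blinfun_apply (op_exp B (- s)) (blinfun_apply (op_exp A s) x)"
  let ?f' = "\<lambda>s. blinfun_apply (op_exp B (- s)) (blinfun_apply (A - B) (blinfun_apply (op_exp A s) x))"
  have inv: "((\<lambda>s. op_exp B (- s)) has_vector_derivative - (op_exp B (- s) o\<^sub>L B)) (at s)" for s
    using vector_diff_chain_at[of uminus "-1" s, OF _ op_exp_has_vector_derivative[of B "- s"]]
      op_exp_skew_commute[OF B, of B]
    by (simp add: o_def has_vector_derivative_minus)
  have deriv: "(?f has_vector_derivative ?f' s) (at s)" for s
    using bounded_bilinear.has_vector_derivative[OF bounded_bilinear_blinfun_apply inv
        op_exp_apply_has_vector_derivative, of A x s]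
    by (simp add: blinfun.bilinear_simps)
  have "A o\<^sub>L (A - B) = (A - B) o\<^sub>L A"
    using comm by (simp add: bounded_bilinear.diff_left[OF bounded_bilinear_blinfun_compose]
        bounded_bilinear.diff_right[OF bounded_bilinear_blinfun_compose])
  then have "(A - B) o\<^sub>L op_exp A s = op_exp A s o\<^sub>L (A - B)" for s
    using op_exp_skew_commute[OF A] by metis
  then have "blinfun_apply (A - B) (blinfun_apply (op_exp A s) x)
      = blinfun_apply (op_exp A s) (blinfun_apply (A - B) x)" for s
    by (metis blinfun_apply_blinfun_compose)
  then have "norm (?f' s) \<le> norm (blinfun_apply (A - B) x)" for s
    by (simp add: norm_op_exp_skew[OF A] norm_op_exp_skew[OF B])
  from norm_increment_le[OF deriv this, of t 0]
  have le: "norm (?f t - x) \<le> norm (blinfun_apply (A - B) x) * \<bar>t\<bar>"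
    by (simp add: op_exp_0)
  have "op_exp B t o\<^sub>L op_exp B (- t) = id_blinfun"
    using op_exp_skew_add[OF B, of t "- t"] by (simp add: op_exp_0)
  then have "blinfun_apply (op_exp B t) (blinfun_apply (op_exp B (- t)) y) = y" for y
    by (metis blinfun_apply_blinfun_compose blinfun_apply_id_blinfun)
  then have "blinfun_apply (op_exp A t) x - blinfun_apply (op_exp B t) x = blinfun_apply (op_exp B t) (?f t - x)"
    by (simp add: blinfun.diff_right)
  with le show ?thesis
    by (simp add: norm_op_exp_skew[OF B] blinfun.diff_left)
qed

section \<open>Resolvents of a self-adjoint operator\<close>

text \<open>Approximate \<open>x\<close> by a point of the dense set; the common bound controls the error for all \<open>t\<close>
  at once.\<close>

lemma tendsto_zero_from_dense:
  fixes T :: "'c \<Rightarrow> 'a::real_normed_vector \<Rightarrow> 'b::real_normed_vector"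
  assumes add: "\<And>t x y. T t (x + y) = T t x + T t y"
    and bound: "\<forall>\<^sub>F t in F. \<forall>x. norm (T t x) \<le> K * norm x"
    and dense: "closure X = UNIV"
    and conv: "\<And>x. x \<in> X \<Longrightarrow> ((\<lambda>t. T t x) \<longlongrightarrow> 0) F"
  shows "((\<lambda>t. T t x) \<longlongrightarrow> 0) F"
proof (rule tendstoI)
  fix e :: real assume e: "0 < e"
  define M where "M = \<bar>K\<bar> + 1"
  have M: "0 < M" "K \<le> M"
    by (auto simp: M_def)
  have "x \<in> closure X"
    by (simp add: dense)
  then obtain y where y: "y \<in> X" "dist y x < e / (2 * M)"
    using closure_approachable[of x X] e M(1) by (meson divide_pos_pos mult_pos_pos zero_less_numeral)
  have "\<forall>\<^sub>F t in F. norm (T t y) < e / 2"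
    using tendstoD[OF conv[OF y(1)], of "e / 2"] e by simp
  with bound show "\<forall>\<^sub>F t in F. dist (T t x) 0 < e"
  proof eventually_elim
    case (elim t)
    have "norm (T t (x - y)) \<le> K * norm (x - y)"
      using elim by blast
    also have "\<dots> \<le> M * norm (x - y)"
      by (intro mult_right_mono M) simp
    also have "\<dots> \<le> M * (e / (2 * M))"
      using y(2) M by (intro mult_left_mono) (auto simp: dist_norm norm_minus_commute)
    finally have "norm (T t (x - y)) \<le> e / 2"
      using M by simp
    moreover have "T t x = T t y + T t (x - y)"
      using add[of t y "x - y"] by simp
    ultimately show ?case
      using norm_triangle_ineq[of "T t y" "T t (x - y)"] elim by simp
  qed
qed

locale self_adjoint_operator =
  fixes D :: "'h::complex_hilbert \<rightharpoonup> 'h"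
  assumes self_adjoint: "self_adjoint D"
begin

lemma dom_dense: "closure (dom D) = UNIV"
  and D_add: "D x = Some x' \<Longrightarrow> D y = Some y' \<Longrightarrow> D (x + y) = Some (x' + y')"
  and D_scaleC: "D x = Some x' \<Longrightarrow> D (c *\<^sub>C x) = Some (c *\<^sub>C x')"
  using self_adjoint unfolding self_adjoint_def densely_defined_linear_def by blast+

lemma D_zero: "D 0 = Some 0"
proof -
  have "dom D \<noteq> {}"
    using dom_dense by auto
  then obtain x x' where "D x = Some x'"
    by blast
  from D_scaleC[OF this, of 0] show ?thesis
    by simp
qed

lemma D_diff:
  assumes "D x = Some x'" "D y = Some y'"
  shows "D (x - y) = Some (x' - y')"
  using D_add[OF assms(1) D_scaleC[OF assms(2), of "-1"]] by (simp add: scaleC_minus_left)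

lemma D_symmetric:
  assumes x: "D x = Some x'" and y: "D y = Some y'"
  shows "cinner x' y = cinner x y'"
proof -
  let ?P = "\<lambda>w. \<forall>\<xi>\<in>dom D. cinner (the (D \<xi>)) y = cinner \<xi> w"
  have adj: "unbounded_adj D y = Some y'"
    using self_adjoint y by (simp add: self_adjoint_def)
  then obtain w where w: "?P w" and y': "y' = (THE w. ?P w)"
    unfolding unbounded_adj_def by (auto split: if_splits)
  have "v = w" if "?P v" for v
    using that w by (intro cinner_eqI[OF dom_dense]) auto
  then have "?P y'"
    unfolding y' using w by (rule theI[rotated])
  then show ?thesis
    using x by force
qed

lemma D_eqI:
  assumes "\<And>x x'. D x = Some x' \<Longrightarrow> cinner x' y = cinner x z"
  shows "D y = Some z"
proof -
  let ?P = "\<lambda>w. \<forall>\<xi>\<in>dom D. cinner (the (D \<xi>)) y = cinner \<xi> w"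
  have z: "?P z"
    using assms by auto
  moreover have "v = z" if "?P v" for v
    using that z by (intro cinner_eqI[OF dom_dense]) auto
  ultimately have "(THE w. ?P w) = z"
    by (rule the_equality)
  with z have "unbounded_adj D y = Some z"
    unfolding unbounded_adj_def by auto
  then show ?thesis
    using self_adjoint by (simp add: self_adjoint_def)
qed

lemma D_closed:
  assumes D: "\<And>n. D (f n) = Some (g n)" and f: "f \<longlonglongrightarrow> y" and g: "g \<longlonglongrightarrow> z"
  shows "D y = Some z"
proof (rule D_eqI)
  fix x x' assume x: "D x = Some x'"
  have "(\<lambda>n. cinner x' (f n)) \<longlonglongrightarrow> cinner x' y"
    by (intro cinner.tendsto tendsto_const f)
  moreover have "(\<lambda>n. cinner x (g n)) \<longlonglongrightarrow> cinner x z"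
    by (intro cinner.tendsto tendsto_const g)
  ultimately show "cinner x' y = cinner x z"
    unfolding D_symmetric[OF x D] by (rule LIMSEQ_unique)
qed

text \<open>The cross term vanishes because \<open>\<langle>D y, y\<rangle>\<close> is real.\<close>

lemma norm_shifted:
  assumes y: "D y = Some y'"
  shows "(norm (y + (\<i> * complex_of_real l) *\<^sub>C y'))\<^sup>2 = (norm y)\<^sup>2 + (l * norm y')\<^sup>2"
proof -
  let ?c = "\<i> * complex_of_real l"
  have "Im (cinner y y') = 0"
    using arg_cong[OF cinner_commute[of y y'], of Im] D_symmetric[OF y y] by simp
  then have "inner y (?c *\<^sub>C y') = 0"
    by (simp add: Re_cinner[symmetric] cinner_scaleC_right)
  then have "(norm (y + ?c *\<^sub>C y'))\<^sup>2 = (norm y)\<^sup>2 + (norm (?c *\<^sub>C y'))\<^sup>2"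
    by (simp add: power2_norm_eq_inner inner_simps inner_commute)
  then show ?thesis
    by (simp add: norm_scaleC norm_mult power_mult_distrib)
qed

lemma norm_le_shifted:
  assumes "D y = Some y'"
  shows "norm y \<le> norm (y + (\<i> * complex_of_real l) *\<^sub>C y')"
  by (rule power2_le_imp_le) (simp_all add: norm_shifted[OF assms])

text \<open>The range of \<open>1 + i l D\<close> is closed since \<open>D\<close> is closed and the inverse is contractive. A vector
  orthogonal to it lies in the domain of the adjoint, that is of \<open>D\<close>, and is an eigenvector with an
  imaginary eigenvalue; hence it is zero.\<close>

lemma shifted_surj:
  assumes l: "l \<noteq> 0"
  shows "\<exists>y y'. D y = Some y' \<and> y + (\<i> * complex_of_real l) *\<^sub>C y' = x"
proof -
  define c where "c = \<i> * complex_of_real l"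
  have c: "c \<noteq> 0" "cnj c = - c"
    using l by (auto simp: c_def)
  define S where "S = {y + c *\<^sub>C y' | y y'. D y = Some y'}"
  have "closed S"
    unfolding closed_sequential_limits
  proof (intro allI impI, elim conjE)
    fix s z assume s: "\<forall>n. s n \<in> S" and lim: "s \<longlonglongrightarrow> z"
    from s obtain f g where fg: "\<And>n. D (f n) = Some (g n)" and s_eq: "\<And>n. s n = f n + c *\<^sub>C g n"
      unfolding S_def by (simp only: mem_Collect_eq) metis
    have le: "norm (f m - f n) \<le> norm (s m - s n)" for m n
      using norm_le_shifted[OF D_diff[OF fg fg], of m n l]
      by (simp add: s_eq c_def scaleC_diff_right algebra_simps)
    have "Cauchy f"
    proof (rule CauchyI)
      fix e :: real assume "0 < e"
      then show "\<exists>M. \<forall>m\<ge>M. \<forall>n\<ge>M. norm (f m - f n) < e"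
        using CauchyD[OF LIMSEQ_imp_Cauchy[OF lim]] le by (meson le_less_trans)
    qed
    then obtain y where y: "f \<longlonglongrightarrow> y"
      using Cauchy_convergent_iff convergent_def by blast
    have g_eq: "g n = inverse c *\<^sub>C (s n - f n)" for n
      using c by (simp add: s_eq scaleC_scaleC)
    have "g \<longlonglongrightarrow> inverse c *\<^sub>C (z - y)"
      unfolding g_eq by (intro bounded_linear.tendsto[OF bounded_linear_scaleC] tendsto_diff lim y)
    then have "D y = Some (inverse c *\<^sub>C (z - y))"
      by (rule D_closed[OF fg y])
    moreover have "z = y + c *\<^sub>C inverse c *\<^sub>C (z - y)"
      using c by (simp add: scaleC_scaleC)
    ultimately show "z \<in> S"
      unfolding S_def by blast
  qed
  moreover have "0 \<in> S"
    unfolding S_def using D_zero by force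
  moreover have "u + v \<in> S" if "u \<in> S" "v \<in> S" for u v
  proof -
    from that obtain y y' w w' where "D y = Some y'" "u = y + c *\<^sub>C y'" "D w = Some w'" "v = w + c *\<^sub>C w'"
      unfolding S_def by blast
    moreover from this have "u + v = (y + w) + c *\<^sub>C (y' + w')"
      by (simp add: scaleC_add_right)
    ultimately show ?thesis
      unfolding S_def using D_add by blast
  qed
  moreover have "d *\<^sub>C u \<in> S" if "u \<in> S" for d u
  proof -
    from that obtain y y' where "D y = Some y'" "u = y + c *\<^sub>C y'"
      unfolding S_def by blast
    moreover from this have "d *\<^sub>C u = d *\<^sub>C y + c *\<^sub>C (d *\<^sub>C y')"
      by (simp add: scaleC_add_right scaleC_scaleC mult.commute)
    ultimately show ?thesis
      unfolding S_def using D_scaleC by blast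
  qed
  ultimately have "\<exists>p\<in>S. \<forall>s\<in>S. cinner s (x - p) = 0"
    by (rule orthogonal_projection_exists_complex[of S x]) blast+
  then obtain p where p: "p \<in> S" "\<And>s. s \<in> S \<Longrightarrow> cinner s (x - p) = 0"
    by blast
  let ?q = "x - p"
  have "D ?q = Some (inverse c *\<^sub>C ?q)"
  proof (rule D_eqI)
    fix y y' assume "D y = Some y'"
    then have "cinner (y + c *\<^sub>C y') ?q = 0"
      by (intro p(2)) (auto simp: S_def)
    then have "cinner y ?q + c * cinner y' ?q = 0"
      by (simp add: cinner_add_left cinner_scaleC_left)
    then have "cinner y' ?q = - inverse c * cinner y ?q"
      using c(1) by (simp add: field_simps add_eq_0_iff)
    then show "cinner y' ?q = cinner y (inverse c *\<^sub>C ?q)"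
      by (simp add: cinner_scaleC_right c(2))
  qed
  then have "?q + c *\<^sub>C inverse c *\<^sub>C ?q \<in> S"
    unfolding S_def by blast
  then have "cinner (?q + ?q) ?q = 0"
    using p(2) c(1) by (simp add: scaleC_scaleC)
  then have "?q = 0"
    by (simp add: cinner_add_left cinner_self)
  then show ?thesis
    using p(1) unfolding S_def c_def by auto
qed

text \<open>The inverse of \<open>1 + i l D\<close>, for \<open>l \<noteq> 0\<close>.\<close>

definition resolvent :: "real \<Rightarrow> 'h \<Rightarrow>\<^sub>L 'h" where
  "resolvent l = Blinfun (\<lambda>x. THE y. \<exists>y'. D y = Some y' \<and> y + (\<i> * complex_of_real l) *\<^sub>C y' = x)"

context
  fixes l :: real
  assumes l: "l \<noteq> 0"
begin

lemma resolvent_bounded_linear: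
  defines "r \<equiv> \<lambda>x. THE y. \<exists>y'. D y = Some y' \<and> y + (\<i> * complex_of_real l) *\<^sub>C y' = x"
  shows "bounded_linear r" and "D y = Some y' \<Longrightarrow> r (y + (\<i> * complex_of_real l) *\<^sub>C y') = y"
proof -
  define c where "c = \<i> * complex_of_real l"
  have r: "r (y + c *\<^sub>C y') = y" if y: "D y = Some y'" for y y'
    unfolding r_def
  proof (rule the_equality)
    fix z assume "\<exists>z'. D z = Some z' \<and> z + (\<i> * complex_of_real l) *\<^sub>C z' = y + c *\<^sub>C y'"
    then obtain z' where z: "D z = Some z'" "z + c *\<^sub>C z' = y + c *\<^sub>C y'"
      by (auto simp: c_def)
    have "(z - y) + c *\<^sub>C (z' - y') = 0"
      using z(2) by (simp add: scaleC_diff_right algebra_simps)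
    then show "z = y"
      using norm_le_shifted[OF D_diff[OF z(1) y], of l] by (simp add: c_def)
  qed (use y in \<open>auto simp: c_def\<close>)
  show "D y = Some y' \<Longrightarrow> r (y + (\<i> * complex_of_real l) *\<^sub>C y') = y"
    using r by (simp add: c_def)
  show "bounded_linear r"
  proof (rule bounded_linear_intro[where K = 1])
    fix x1 x2 :: 'h and s :: real
    obtain y1 z1 where 1: "D y1 = Some z1" "x1 = y1 + c *\<^sub>C z1"
      using shifted_surj[OF l, of x1] c_def by metis
    obtain y2 z2 where 2: "D y2 = Some z2" "x2 = y2 + c *\<^sub>C z2"
      using shifted_surj[OF l, of x2] c_def by metis
    have "r (x1 + x2) = r ((y1 + y2) + c *\<^sub>C (z1 + z2))"
      by (simp add: 1 2 scaleC_add_right algebra_simps)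
    then show "r (x1 + x2) = r x1 + r x2"
      using r[OF D_add[OF 1(1) 2(1)]] r[OF 1(1)] r[OF 2(1)] by (simp add: 1(2) 2(2))
    have "D (s *\<^sub>R y1) = Some (s *\<^sub>R z1)"
      using D_scaleC[OF 1(1), of "complex_of_real s"] by (simp add: scaleC_of_real)
    from r[OF this] show "r (s *\<^sub>R x1) = s *\<^sub>R r x1"
      using r[OF 1(1)] by (simp add: 1(2) scaleC_scaleR scaleR_add_right)
    show "norm (r x1) \<le> norm x1 * 1"
      using r[OF 1(1)] norm_le_shifted[OF 1(1), of l] by (simp add: 1(2) c_def)
  qed
qed

lemma resolvent_shifted:
  "D y = Some y' \<Longrightarrow> blinfun_apply (resolvent l) (y + (\<i> * complex_of_real l) *\<^sub>C y') = y"
  using resolvent_bounded_linear by (simp add: resolvent_def bounded_linear_Blinfun_apply)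

lemma resolventE:
  obtains y' where "D (blinfun_apply (resolvent l) x) = Some y'"
    "blinfun_apply (resolvent l) x + (\<i> * complex_of_real l) *\<^sub>C y' = x"
  using shifted_surj[OF l, of x] resolvent_shifted by metis

lemma norm_resolvent_le: "norm (blinfun_apply (resolvent l) x) \<le> norm x"
  using resolventE[of x] norm_le_shifted by metis

lemma resolvent_in_bounded_ops: "resolvent l \<in> bounded_ops"
proof -
  have "blinfun_apply (resolvent l) (d *\<^sub>C x) = d *\<^sub>C blinfun_apply (resolvent l) x" for d x
  proof -
    obtain y' where y': "D (blinfun_apply (resolvent l) x) = Some y'"
      "blinfun_apply (resolvent l) x + (\<i> * complex_of_real l) *\<^sub>C y' = x"
      by (rule resolventE)
    have "d *\<^sub>C x = d *\<^sub>C blinfun_apply (resolvent l) x + (\<i> * complex_of_real l) *\<^sub>C (d *\<^sub>C y')"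
      by (subst y'(2)[symmetric]) (simp add: scaleC_add_right scaleC_scaleC mult_ac)
    then show ?thesis
      using resolvent_shifted[OF D_scaleC[OF y'(1), of d]] by simp
  qed
  then show ?thesis
    by (simp add: bounded_ops_def)
qed

lemma resolvent_of_dom:
  assumes x: "D x = Some x'"
  shows "blinfun_apply (resolvent l) x
    = x - (\<i> * complex_of_real l) *\<^sub>C blinfun_apply (resolvent l) x'"
  using resolvent_shifted[OF x]
  by (simp add: blinfun.add_right bounded_ops_scaleC[OF resolvent_in_bounded_ops] algebra_simps)

lemma D_resolvent:
  assumes x: "D x = Some x'"
  shows "D (blinfun_apply (resolvent l) x) = Some (blinfun_apply (resolvent l) x')"
proof -
  let ?c = "\<i> * complex_of_real l"
  obtain y' where y': "D (blinfun_apply (resolvent l) x) = Some y'"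
    "blinfun_apply (resolvent l) x + ?c *\<^sub>C y' = x"
    by (rule resolventE)
  then have "?c *\<^sub>C y' = ?c *\<^sub>C blinfun_apply (resolvent l) x'"
    using resolvent_of_dom[OF x] by (simp add: algebra_simps)
  then have "inverse ?c *\<^sub>C ?c *\<^sub>C y' = inverse ?c *\<^sub>C ?c *\<^sub>C blinfun_apply (resolvent l) x'"
    by (rule arg_cong)
  then have "y' = blinfun_apply (resolvent l) x'"
    using l by (simp add: scaleC_scaleC left_inverse del: inverse_mult_distrib)
  with y'(1) show ?thesis by simp
qed

end

text \<open>Write \<open>x = (1 + i l D) u\<close> and \<open>y = (1 - i l D) v\<close>; then both sides are \<open>\<langle>u, v\<rangle> + i l \<langle>D u, v\<rangle>\<close> by
  the symmetry of \<open>D\<close>.\<close>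

lemma cinner_resolvent:
  assumes l: "l \<noteq> 0"
  shows "cinner (blinfun_apply (resolvent l) x) y = cinner x (blinfun_apply (resolvent (- l)) y)"
proof -
  let ?c = "\<i> * complex_of_real l"
  define u where "u = blinfun_apply (resolvent l) x"
  define v where "v = blinfun_apply (resolvent (- l)) y"
  obtain u' where u': "D u = Some u'" "u + ?c *\<^sub>C u' = x"
    unfolding u_def by (rule resolventE[OF l])
  obtain v' where v': "D v = Some v'" "v + (- ?c) *\<^sub>C v' = y"
    unfolding v_def using resolventE[of "- l" y] l by auto
  have "cinner u y = cinner u v + ?c * cinner u v'"
    by (subst v'(2)[symmetric]) (simp add: cinner_add_right cinner_scaleC_right)
  also have "\<dots> = cinner x v"
    by (subst u'(2)[symmetric])
       (simp add: cinner_add_left cinner_scaleC_left D_symmetric[OF u'(1) v'(1)])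
  finally show ?thesis
    by (simp add: u_def v_def)
qed

lemma resolvent_commute:
  assumes l: "l \<noteq> 0" and m: "m \<noteq> 0"
  shows "blinfun_apply (resolvent l) (blinfun_apply (resolvent m) x)
    = blinfun_apply (resolvent m) (blinfun_apply (resolvent l) x)"
proof -
  let ?y = "blinfun_apply (resolvent m) (blinfun_apply (resolvent l) x)"
  obtain z where z: "D (blinfun_apply (resolvent l) x) = Some z"
    "blinfun_apply (resolvent l) x + (\<i> * complex_of_real l) *\<^sub>C z = x"
    by (rule resolventE[OF l])
  have "blinfun_apply (resolvent m) x = ?y + (\<i> * complex_of_real l) *\<^sub>C blinfun_apply (resolvent m) z"
    using arg_cong[OF z(2), of "blinfun_apply (resolvent m)"]
    by (simp add: blinfun.add_right bounded_ops_scaleC[OF resolvent_in_bounded_ops[OF m]])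
  then show ?thesis
    using resolvent_shifted[OF l D_resolvent[OF m z(1)]] by simp
qed

text \<open>On the domain \<open>R x - x = - i l R D x\<close>, which is of order \<open>l\<close> because \<open>R\<close> is contractive.\<close>

lemma resolvent_tendsto_id: "((\<lambda>l. blinfun_apply (resolvent l) x) \<longlongrightarrow> x) (at 0)"
proof -
  let ?T = "\<lambda>l x. blinfun_apply (resolvent l) x - x"
  have "((\<lambda>l. ?T l x) \<longlongrightarrow> 0) (at 0)"
  proof (rule tendsto_zero_from_dense[OF _ _ dom_dense, of ?T])
    show "\<forall>\<^sub>F l in at 0. \<forall>x. norm (?T l x) \<le> 2 * norm x"
      unfolding eventually_at_filter
    proof (intro always_eventually allI impI)
      fix l :: real and x assume "l \<noteq> 0"
      then show "norm (?T l x) \<le> 2 * norm x"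
        using norm_resolvent_le[of l x] norm_triangle_ineq4[of "blinfun_apply (resolvent l) x" x] by simp
    qed
  next
    fix x assume "x \<in> dom D"
    then obtain x' where x: "D x = Some x'" by blast
    show "((\<lambda>l. ?T l x) \<longlongrightarrow> 0) (at 0)"
    proof (rule Lim_null_comparison)
      show "\<forall>\<^sub>F l in at 0. norm (?T l x) \<le> \<bar>l\<bar> * norm x'"
        unfolding eventually_at_filter
      proof (intro always_eventually allI impI)
        fix l :: real assume l: "l \<noteq> 0"
        show "norm (?T l x) \<le> \<bar>l\<bar> * norm x'"
          using norm_resolvent_le[OF l, of x']
          by (simp add: resolvent_of_dom[OF l x] norm_scaleC norm_mult mult_left_mono)
      qed
      show "((\<lambda>l. \<bar>l\<bar> * norm x') \<longlongrightarrow> 0) (at 0)"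
        by (auto intro!: tendsto_eq_intros)
    qed
  qed (simp add: blinfun.add_right)
  then show ?thesis
    by (simp add: LIM_zero_iff)
qed

text \<open>The bounded operator \<open>i D (1 + l\<^sup>2 D\<^sup>2)\<^sup>-\<^sup>1\<close>, expressed through resolvents, approximates \<open>i D\<close>. Unlike the one-sided
  Yosida approximation \<open>i D (1 + i l D)\<^sup>-\<^sup>1\<close> it is skew, so that it generates isometries in both
  directions of time.\<close>

definition skew_approx :: "real \<Rightarrow> 'h \<Rightarrow>\<^sub>L 'h" where
  "skew_approx l = (1 / (2 * l)) *\<^sub>R (resolvent (- l) - resolvent l)"

lemma skew_approx_in_bounded_ops: "l \<noteq> 0 \<Longrightarrow> skew_approx l \<in> bounded_ops"
  unfolding skew_approx_def
  by (intro scaleR_in_bounded_ops diff_in_bounded_ops resolvent_in_bounded_ops) simp_all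

lemma skew_approx_skew:
  assumes l: "l \<noteq> 0"
  shows "inner (blinfun_apply (skew_approx l) x) x = 0"
proof -
  have "Re (cinner (blinfun_apply (resolvent (- l)) x) x) = Re (cinner (blinfun_apply (resolvent l) x) x)"
    using l cinner_commute[of "blinfun_apply (resolvent (- l)) x" x] by (simp add: cinner_resolvent)
  then show ?thesis
    by (simp add: skew_approx_def blinfun.scaleR_left blinfun.diff_left inner_simps Re_cinner)
qed

lemma skew_approx_commute:
  assumes "l \<noteq> 0" "m \<noteq> 0"
  shows "skew_approx l o\<^sub>L skew_approx m = skew_approx m o\<^sub>L skew_approx l"
  using assms
  by (intro blinfun_eqI)
     (simp add: skew_approx_def blinfun.bilinear_simps resolvent_commute[of l m]
      resolvent_commute[of "-l" m] resolvent_commute[of l "-m"] resolvent_commute[of "-l" "-m"] algebra_simps)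

text \<open>On the domain the approximant is \<open>i D\<close> followed by the average of two resolvents, which tends
  to the identity.\<close>

lemma skew_approx_of_dom:
  assumes l: "l \<noteq> 0" and x: "D x = Some x'"
  shows "blinfun_apply (skew_approx l) x
    = \<i> *\<^sub>C ((1/2) *\<^sub>R (blinfun_apply (resolvent l) x' + blinfun_apply (resolvent (- l)) x'))"
proof -
  let ?r = "blinfun_apply (resolvent l) x'" and ?s = "blinfun_apply (resolvent (- l)) x'"
  have "blinfun_apply (resolvent (- l)) x - blinfun_apply (resolvent l) x
      = (\<i> * complex_of_real l) *\<^sub>C (?r + ?s)"
    using l by (simp add: resolvent_of_dom[OF _ x] scaleC_minus_left scaleC_add_right algebra_simps)
  also have "\<dots> = l *\<^sub>R \<i> *\<^sub>C (?r + ?s)"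
    by (metis scaleC_of_real scaleC_scaleC mult.commute)
  finally show ?thesis
    using l by (simp add: skew_approx_def blinfun.scaleR_left blinfun.diff_left scaleC_scaleR)
qed

lemma skew_approx_tendsto:
  assumes x: "D x = Some x'"
  shows "((\<lambda>l. blinfun_apply (skew_approx l) x) \<longlongrightarrow> \<i> *\<^sub>C x') (at 0)"
proof -
  have "filterlim uminus (at 0) (at (0::real))"
    unfolding filterlim_at by (auto simp: eventually_at_filter intro!: tendsto_eq_intros)
  then have m: "((\<lambda>l. blinfun_apply (resolvent (- l)) x') \<longlongrightarrow> x') (at 0)"
    by (rule filterlim_compose[OF resolvent_tendsto_id])
  have "((\<lambda>l. \<i> *\<^sub>C ((1/2) *\<^sub>R (blinfun_apply (resolvent l) x' + blinfun_apply (resolvent (- l)) x')))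
      \<longlongrightarrow> \<i> *\<^sub>C ((1/2) *\<^sub>R (x' + x'))) (at 0)"
    by (intro bounded_linear.tendsto[OF bounded_linear_scaleC] tendsto_intros resolvent_tendsto_id m)
  moreover have "\<forall>\<^sub>F l in at 0. \<i> *\<^sub>C ((1/2) *\<^sub>R (blinfun_apply (resolvent l) x' + blinfun_apply (resolvent (- l)) x'))
      = blinfun_apply (skew_approx l) x"
    unfolding eventually_at_filter by (simp add: skew_approx_of_dom[OF _ x])
  ultimately show ?thesis
    by (simp add: scaleR_2[symmetric] Lim_transform_eventually)
qed

end

section \<open>Stone's theorem: a self-adjoint operator generates a unitary group\<close>

lemma has_vector_derivative_at_0_iff:
  fixes f :: "real \<Rightarrow> 'a::real_normed_vector"
  shows "(f has_vector_derivative d) (at 0) \<longleftrightarrow> ((\<lambda>t. (f t - f 0) /\<^sub>R t - d) \<longlongrightarrow> 0) (at 0)"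
proof -
  have "norm (f t - f 0 - t *\<^sub>R d) / norm t = norm ((f t - f 0) /\<^sub>R t - d)" if "t \<noteq> 0" for t
  proof -
    have "(f t - f 0) /\<^sub>R t - d = (f t - f 0 - t *\<^sub>R d) /\<^sub>R t"
      using that by (simp add: scaleR_diff_right)
    then show ?thesis
      by (simp add: divide_inverse)
  qed
  then have "((\<lambda>t. norm (f t - f 0 - t *\<^sub>R d) / norm t) \<longlongrightarrow> 0) (at 0)
      \<longleftrightarrow> ((\<lambda>t. norm ((f t - f 0) /\<^sub>R t - d)) \<longlongrightarrow> 0) (at 0)"
    by (intro filterlim_cong) (auto simp: eventually_at_filter)
  then show ?thesis
    by (simp add: has_vector_derivative_def has_derivative_at bounded_linear_scaleR_left tendsto_norm_zero_iff)
qed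

lemma Cauchy_iff_tendsto_diff:
  fixes f :: "nat \<Rightarrow> 'a::real_normed_vector"
  shows "Cauchy f \<longleftrightarrow> ((\<lambda>(n, m). f n - f m) \<longlongrightarrow> 0) (sequentially \<times>\<^sub>F sequentially)"
  unfolding Cauchy_def tendsto_iff eventually_prod_sequentially
  by (simp add: dist_norm norm_minus_commute)

context self_adjoint_operator
begin

text \<open>A sequence of approximants of \<open>i D\<close>; the group \<open>e\<^sup>i\<^sup>t\<^sup>D\<close> will be the strong limit of the flows
  that they generate.\<close>

definition approx :: "nat \<Rightarrow> 'h \<Rightarrow>\<^sub>L 'h" where
  "approx n = skew_approx (inverse (real (Suc n)))"

definition approx_flow :: "nat \<Rightarrow> real \<Rightarrow> 'h \<Rightarrow>\<^sub>L 'h" where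
  "approx_flow n = op_exp (approx n)"

lemma approx_skew: "inner (blinfun_apply (approx n) x) x = 0"
  unfolding approx_def by (rule skew_approx_skew) simp

lemma approx_tendsto:
  assumes "D x = Some x'"
  shows "(\<lambda>n. blinfun_apply (approx n) x) \<longlonglongrightarrow> \<i> *\<^sub>C x'"
proof -
  have "filterlim (\<lambda>n. inverse (real (Suc n))) (at 0) sequentially"
    unfolding filterlim_at using LIMSEQ_inverse_real_of_nat by simp
  then show ?thesis
    unfolding approx_def by (rule filterlim_compose[OF skew_approx_tendsto[OF assms]])
qed

lemma norm_approx_flow: "norm (blinfun_apply (approx_flow n t) x) = norm x"
  unfolding approx_flow_def by (rule norm_op_exp_skew) (rule approx_skew)

lemma approx_flow_commute_approx:
  "blinfun_apply (approx n) (blinfun_apply (approx_flow n t) x)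
    = blinfun_apply (approx_flow n t) (blinfun_apply (approx n) x)"
  using op_exp_skew_commute[OF approx_skew, of "approx n" n t] unfolding approx_flow_def
  by (metis blinfun_apply_blinfun_compose)

lemma approx_flow_in_bounded_ops: "approx_flow n t \<in> bounded_ops"
proof -
  have "blinfun_apply (approx_flow n t) (c *\<^sub>C x) = c *\<^sub>C blinfun_apply (approx_flow n t) x" for c x
  proof -
    let ?C = "scaleC_op c id_blinfun"
    have "approx n \<in> bounded_ops"
      unfolding approx_def by (rule skew_approx_in_bounded_ops) simp
    then have "?C o\<^sub>L approx n = approx n o\<^sub>L ?C"
      by (intro blinfun_eqI) (simp add: scaleC_op_apply bounded_ops_scaleC)
    then have "?C o\<^sub>L approx_flow n t = approx_flow n t o\<^sub>L ?C"
      unfolding approx_flow_def by (rule op_exp_skew_commute[OF approx_skew])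
    then show ?thesis
      by (metis blinfun_apply_blinfun_compose blinfun_apply_id_blinfun scaleC_op_apply)
  qed
  then show ?thesis
    by (simp add: bounded_ops_def)
qed

text \<open>For \<open>x\<close> in the domain, two of the flows separate at most at the speed by which their generators
  differ at \<open>x\<close>, and these converge. Density extends this to all \<open>x\<close>, as the flows are isometric.\<close>

lemma approx_flow_Cauchy: "Cauchy (\<lambda>n. blinfun_apply (approx_flow n t) x)"
proof -
  let ?T = "\<lambda>p x. blinfun_apply (approx_flow (fst p) t) x - blinfun_apply (approx_flow (snd p) t) x"
  have "((\<lambda>p. ?T p x) \<longlongrightarrow> 0) (sequentially \<times>\<^sub>F sequentially)"
  proof (rule tendsto_zero_from_dense[OF _ _ dom_dense, of ?T])
    have "norm (?T p x) \<le> 2 * norm x" for p x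
      using norm_triangle_ineq4 by (rule order_trans) (simp add: norm_approx_flow)
    then show "\<forall>\<^sub>F p in sequentially \<times>\<^sub>F sequentially. \<forall>x. norm (?T p x) \<le> 2 * norm x"
      by simp
  next
    fix x assume "x \<in> dom D"
    then obtain x' where x: "D x = Some x'" by blast
    let ?B = "\<lambda>n. blinfun_apply (approx n) x"
    have "Cauchy ?B"
      by (rule LIMSEQ_imp_Cauchy[OF approx_tendsto[OF x]])
    then have lim: "((\<lambda>p. norm (?B (fst p) - ?B (snd p)) * \<bar>t\<bar>) \<longlongrightarrow> 0) (sequentially \<times>\<^sub>F sequentially)"
      unfolding Cauchy_iff_tendsto_diff case_prod_beta
      by (intro tendsto_mult_left_zero tendsto_norm_zero)
    have "norm (?T p x) \<le> norm (?B (fst p) - ?B (snd p)) * \<bar>t\<bar>" for p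
      unfolding approx_flow_def
      by (rule op_exp_skew_difference[OF approx_skew approx_skew])
         (simp add: approx_def skew_approx_commute)
    then show "((\<lambda>p. ?T p x) \<longlongrightarrow> 0) (sequentially \<times>\<^sub>F sequentially)"
      by (intro Lim_null_comparison[OF _ lim] always_eventually allI)
  qed (simp add: blinfun.add_right)
  then show ?thesis
    unfolding Cauchy_iff_tendsto_diff case_prod_beta .
qed

text \<open>The velocity of the path \<open>e\<^sup>s\<^sup>B x\<close> is \<open>e\<^sup>s\<^sup>B B x\<close>. The isometry \<open>e\<^sup>s\<^sup>B\<close> moves \<open>B x\<close> at most by twice the
  distance of \<open>B x\<close> to \<open>v\<close>, plus the displacement of \<open>v\<close>. Choosing \<open>v\<close> in the domain of \<open>D\<close> will keep
  the bound uniform in the approximation.\<close>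

lemma approx_flow_remainder:
  "norm (blinfun_apply (approx_flow n t) x - x - t *\<^sub>R blinfun_apply (approx n) x)
    \<le> \<bar>t\<bar> * (2 * norm (blinfun_apply (approx n) x - v) + \<bar>t\<bar> * norm (blinfun_apply (approx n) v))"
proof -
  let ?E = "\<lambda>s. blinfun_apply (approx_flow n s)" and ?w = "blinfun_apply (approx n) x"
  have deriv: "((\<lambda>s. ?E s y) has_vector_derivative ?E s (blinfun_apply (approx n) y)) (at s within S)" for y s S
    using op_exp_apply_has_vector_derivative[of "approx n" y s S]
    by (simp add: approx_flow_def[symmetric] approx_flow_commute_approx)
  have E0: "?E 0 y = y" for y
    by (simp add: approx_flow_def op_exp_0)
  have move: "norm (?E s v - v) \<le> norm (blinfun_apply (approx n) v) * \<bar>s\<bar>" for s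
    using norm_increment_le[of "\<lambda>s. ?E s v" _ _ s 0, OF deriv] by (simp add: norm_approx_flow E0)
  have "norm (?E t x - ?E 0 x - (t - 0) *\<^sub>R ?E 0 ?w)
      \<le> norm (t - 0) * (2 * norm (?w - v) + \<bar>t\<bar> * norm (blinfun_apply (approx n) v))"
  proof (rule vector_differentiable_bound_linearization[OF deriv order_refl])
    fix s assume "s \<in> closed_segment 0 t"
    then have s: "\<bar>s\<bar> \<le> \<bar>t\<bar>"
      by (auto simp: closed_segment_eq_real_ivl split: if_splits)
    have "?E s ?w - ?E 0 ?w = (?E s (?w - v) - (?w - v)) + (?E s v - v)"
      by (simp add: E0 blinfun.diff_right)
    also have "norm \<dots> \<le> (norm (?w - v) + norm (?w - v)) + norm (?E s v - v)"
      by (intro norm_triangle_mono norm_triangle_le_diff order_refl)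
         (simp add: norm_approx_flow)
    also have "norm (?E s v - v) \<le> \<bar>t\<bar> * norm (blinfun_apply (approx n) v)"
      using move[of s] s by (smt (verit) mult.commute mult_left_mono norm_ge_zero)
    finally show "norm (?E s ?w - ?E 0 ?w) \<le> 2 * norm (?w - v) + \<bar>t\<bar> * norm (blinfun_apply (approx n) v)"
      by simp
  qed simp
  then show ?thesis
    by (simp add: E0)
qed

definition stone_group :: "real \<Rightarrow> 'h \<Rightarrow>\<^sub>L 'h" where
  "stone_group t = Blinfun (\<lambda>x. lim (\<lambda>n. blinfun_apply (approx_flow n t) x))"

lemma approx_flow_tendsto: "(\<lambda>n. blinfun_apply (approx_flow n t) x) \<longlonglongrightarrow> blinfun_apply (stone_group t) x"
proof -
  let ?u = "\<lambda>x. lim (\<lambda>n. blinfun_apply (approx_flow n t) x)"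
  have u: "(\<lambda>n. blinfun_apply (approx_flow n t) x) \<longlonglongrightarrow> ?u x" for x
    using approx_flow_Cauchy Cauchy_convergent_iff convergent_LIMSEQ_iff by blast
  have "bounded_linear ?u"
  proof (rule bounded_linear_intro[where K = 1])
    show "?u (x + y) = ?u x + ?u y" for x y
      using tendsto_add[OF u u, of x y] u[of "x + y"] LIMSEQ_unique by (simp add: blinfun.add_right) blast
    show "?u (r *\<^sub>R x) = r *\<^sub>R ?u x" for r x
      using tendsto_scaleR[OF tendsto_const u, of r x] u[of "r *\<^sub>R x"] LIMSEQ_unique
      by (simp add: blinfun.scaleR_right) blast
    show "norm (?u x) \<le> norm x * 1" for x
      using tendsto_norm[OF u, of x] by (simp add: norm_approx_flow LIMSEQ_const_iff)
  qed
  with u show ?thesis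
    by (simp add: stone_group_def bounded_linear_Blinfun_apply)
qed

lemma norm_stone_group: "norm (blinfun_apply (stone_group t) x) = norm x"
  using tendsto_norm[OF approx_flow_tendsto, of t x] by (simp add: norm_approx_flow LIMSEQ_const_iff)

lemma stone_group_in_bounded_ops: "stone_group t \<in> bounded_ops"
proof -
  have "blinfun_apply (stone_group t) (c *\<^sub>C x) = c *\<^sub>C blinfun_apply (stone_group t) x" for c x
  proof (rule LIMSEQ_unique[OF approx_flow_tendsto])
    show "(\<lambda>n. blinfun_apply (approx_flow n t) (c *\<^sub>C x)) \<longlonglongrightarrow> c *\<^sub>C blinfun_apply (stone_group t) x"
      unfolding bounded_ops_scaleC[OF approx_flow_in_bounded_ops]
      by (intro bounded_linear.tendsto[OF bounded_linear_scaleC] approx_flow_tendsto)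
  qed
  then show ?thesis
    by (simp add: bounded_ops_def)
qed

lemma stone_group_0: "stone_group 0 = id_blinfun"
proof (rule blinfun_eqI)
  show "blinfun_apply (stone_group 0) x = blinfun_apply id_blinfun x" for x
    using approx_flow_tendsto[of 0 x] by (simp add: approx_flow_def op_exp_0 LIMSEQ_const_iff)
qed

text \<open>The product of two strongly convergent sequences of isometries converges to the product of the
  limits.\<close>

lemma stone_group_add: "stone_group (s + t) = stone_group s o\<^sub>L stone_group t"
proof (rule blinfun_eqI)
  fix x
  let ?y = "blinfun_apply (stone_group t) x"
  have "(\<lambda>n. blinfun_apply (approx_flow n s) (blinfun_apply (approx_flow n t) x - ?y)) \<longlonglongrightarrow> 0"
    using LIM_zero[OF approx_flow_tendsto[of t x]]
    by (subst tendsto_norm_zero_iff[symmetric]) (simp add: norm_approx_flow tendsto_norm_zero)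
  from tendsto_add[OF this approx_flow_tendsto[of s ?y]]
  have "(\<lambda>n. blinfun_apply (approx_flow n s) (blinfun_apply (approx_flow n t) x)) \<longlonglongrightarrow> blinfun_apply (stone_group s) ?y"
    by (simp add: blinfun.diff_right)
  moreover have "blinfun_apply (approx_flow n s) (blinfun_apply (approx_flow n t) x) = blinfun_apply (approx_flow n (s + t)) x" for n
    using op_exp_skew_add[OF approx_skew, of n s t] by (simp add: approx_flow_def)
  ultimately have "(\<lambda>n. blinfun_apply (approx_flow n (s + t)) x) \<longlonglongrightarrow> blinfun_apply (stone_group s) ?y"
    by simp
  then show "blinfun_apply (stone_group (s + t)) x = blinfun_apply (stone_group s o\<^sub>L stone_group t) x"
    using approx_flow_tendsto LIMSEQ_unique by (simp, blast)
qed

lemma stone_group_unitary: "unitary_op (stone_group t)"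
proof -
  have inv: "stone_group s o\<^sub>L stone_group (- s) = id_blinfun" for s
    using stone_group_add[of s "- s"] by (simp add: stone_group_0)
  have "adj (stone_group t) = stone_group (- t)"
  proof (rule adj_unique[OF stone_group_in_bounded_ops])
    fix x y
    have "y = blinfun_apply (stone_group t) (blinfun_apply (stone_group (- t)) y)"
      using arg_cong[OF inv[of t], of "\<lambda>u. blinfun_apply u y"] by simp
    then show "cinner (blinfun_apply (stone_group t) x) y = cinner x (blinfun_apply (stone_group (- t)) y)"
      using isometry_preserves_cinner[OF stone_group_in_bounded_ops norm_stone_group, of t x] by metis
  qed
  then show ?thesis
    using inv[of t] inv[of "- t"] by (simp add: unitary_op_def stone_group_in_bounded_ops)
qed

lemma stone_group_remainder:
  assumes x: "D x = Some x'" and v: "D v = Some v'"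
  shows "norm (blinfun_apply (stone_group t) x - x - t *\<^sub>R \<i> *\<^sub>C x')
    \<le> \<bar>t\<bar> * (2 * norm (\<i> *\<^sub>C x' - v) + \<bar>t\<bar> * norm v')"
proof (rule LIMSEQ_le)
  show "(\<lambda>n. norm (blinfun_apply (approx_flow n t) x - x - t *\<^sub>R blinfun_apply (approx n) x))
      \<longlonglongrightarrow> norm (blinfun_apply (stone_group t) x - x - t *\<^sub>R \<i> *\<^sub>C x')"
    by (intro tendsto_intros approx_flow_tendsto approx_tendsto x)
  have "(\<lambda>n. \<bar>t\<bar> * (2 * norm (blinfun_apply (approx n) x - v) + \<bar>t\<bar> * norm (blinfun_apply (approx n) v)))
      \<longlonglongrightarrow> \<bar>t\<bar> * (2 * norm (\<i> *\<^sub>C x' - v) + \<bar>t\<bar> * norm (\<i> *\<^sub>C v'))"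
    by (intro tendsto_intros approx_tendsto x v)
  then show "(\<lambda>n. \<bar>t\<bar> * (2 * norm (blinfun_apply (approx n) x - v) + \<bar>t\<bar> * norm (blinfun_apply (approx n) v)))
      \<longlonglongrightarrow> \<bar>t\<bar> * (2 * norm (\<i> *\<^sub>C x' - v) + \<bar>t\<bar> * norm v')"
    by (simp add: norm_scaleC)
qed (use approx_flow_remainder in blast)

lemma stone_group_has_derivative:
  assumes x: "D x = Some x'"
  shows "((\<lambda>t. blinfun_apply (stone_group t) x) has_vector_derivative \<i> *\<^sub>C x') (at 0)"
  unfolding has_vector_derivative_at_0_iff
proof (rule tendstoI)
  fix e :: real assume e: "0 < e"
  have "\<i> *\<^sub>C x' \<in> closure (dom D)"
    by (simp add: dom_dense)
  then obtain v v' where v: "D v = Some v'" "dist v (\<i> *\<^sub>C x') < e / 4"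
    using e unfolding closure_approachable by (metis domD zero_less_divide_iff zero_less_numeral)
  have "((\<lambda>t. \<bar>t\<bar> * norm v') \<longlongrightarrow> 0) (at 0)"
    by (auto intro!: tendsto_eq_intros)
  then have "\<forall>\<^sub>F t in at 0. \<bar>t\<bar> * norm v' < e / 2"
    using e by (intro order_tendstoD) auto
  moreover have "\<forall>\<^sub>F t::real in at 0. t \<noteq> 0"
    by (simp add: eventually_at_filter)
  ultimately show "\<forall>\<^sub>F t in at 0. dist ((blinfun_apply (stone_group t) x - blinfun_apply (stone_group 0) x) /\<^sub>R t
      - \<i> *\<^sub>C x') 0 < e"
  proof eventually_elim
    case (elim t)
    let ?d = "blinfun_apply (stone_group t) x - x"
    have "\<bar>t\<bar> * norm (?d /\<^sub>R t - \<i> *\<^sub>C x') = norm (?d - t *\<^sub>R \<i> *\<^sub>C x')"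
      using elim by (simp add: norm_scaleR[symmetric] scaleR_diff_right del: norm_scaleR)
    also have "\<dots> \<le> \<bar>t\<bar> * (2 * norm (\<i> *\<^sub>C x' - v) + \<bar>t\<bar> * norm v')"
      by (rule stone_group_remainder[OF x v(1)])
    finally have "norm (?d /\<^sub>R t - \<i> *\<^sub>C x') \<le> 2 * norm (\<i> *\<^sub>C x' - v) + \<bar>t\<bar> * norm v'"
      using elim by simp
    then show ?case
      using elim v(2) by (simp add: stone_group_0 dist_norm norm_minus_commute)
  qed
qed

text \<open>Differentiability at 0 gives continuity at 0 on the domain; density extends it to all vectors
  and the group law to all times.\<close>

lemma stone_group_continuous: "continuous_on UNIV (\<lambda>t. blinfun_apply (stone_group t) x)"
proof -
  let ?T = "\<lambda>t x. blinfun_apply (stone_group t) x - x"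
  have "((\<lambda>t. ?T t x) \<longlongrightarrow> 0) (at 0)"
  proof (rule tendsto_zero_from_dense[OF _ _ dom_dense, of ?T])
    have "norm (?T t x) \<le> 2 * norm x" for t x
      using norm_triangle_ineq4 by (rule order_trans) (simp add: norm_stone_group)
    then show "\<forall>\<^sub>F t in at 0. \<forall>x. norm (?T t x) \<le> 2 * norm x"
      by simp
  next
    fix x assume "x \<in> dom D"
    then have "isCont (\<lambda>t. blinfun_apply (stone_group t) x) 0"
      using stone_group_has_derivative has_vector_derivative_continuous by blast
    then show "((\<lambda>t. ?T t x) \<longlongrightarrow> 0) (at 0)"
      by (simp add: isCont_def stone_group_0 LIM_zero_iff)
  qed (simp add: blinfun.add_right)
  then have at0: "((\<lambda>t. blinfun_apply (stone_group t) x) \<longlongrightarrow> x) (at 0)"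
    by (simp add: LIM_zero_iff)
  have "isCont (\<lambda>t. blinfun_apply (stone_group t) x) t" for t
    unfolding isCont_iff stone_group_add blinfun_apply_blinfun_compose
    using bounded_linear.tendsto[OF blinfun.bounded_linear_right at0] .
  then show ?thesis
    by (simp add: continuous_on_eq_continuous_at)
qed

end

text \<open>The property by which \<open>exp_i D\<close> is described, so that it can be proved to have exactly one
  solution.\<close>

definition generates :: "('h::complex_hilbert \<rightharpoonup> 'h) \<Rightarrow> (real \<Rightarrow> 'h \<Rightarrow>\<^sub>L 'h) \<Rightarrow> bool" where
  "generates D U \<longleftrightarrow> unitary_group U \<and>
     (\<forall>\<xi> \<zeta>. D \<xi> = Some \<zeta> \<longleftrightarrow>
        ((\<lambda>t. blinfun_apply (U t) \<xi>) has_vector_derivative \<i> *\<^sub>C \<zeta>) (at 0))"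

lemma norm_unitary_op:
  assumes "unitary_op u"
  shows "norm (blinfun_apply u x) = norm x"
proof -
  have u: "u \<in> bounded_ops" "adj u o\<^sub>L u = id_blinfun"
    using assms by (auto simp: unitary_op_def)
  have "cinner (blinfun_apply u x) (blinfun_apply u x) = cinner x x"
    using cinner_adj[OF u(1), of x "blinfun_apply u x"] arg_cong[OF u(2), of "\<lambda>v. blinfun_apply v x"]
    by simp
  then show ?thesis
    by (simp add: cinner_self power2_eq_iff_nonneg del: of_real_power)
qed

context
  fixes D :: "'h::complex_hilbert \<rightharpoonup> 'h" and U
  assumes gen: "generates D U"
begin

lemma generates_0: "U 0 = id_blinfun"
  and generates_add: "U (s + t) = U s o\<^sub>L U t"
  and generates_in_bounded_ops: "U t \<in> bounded_ops"
  and generates_norm: "norm (blinfun_apply (U t) x) = norm x"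
  and generates_iff: "D x = Some z \<longleftrightarrow>
        ((\<lambda>t. blinfun_apply (U t) x) has_vector_derivative \<i> *\<^sub>C z) (at 0)"
  using gen norm_unitary_op unfolding generates_def unitary_group_def unitary_op_def by blast+

lemma generates_inverse: "blinfun_apply (U t) (blinfun_apply (U (- t)) x) = x"
  using generates_add[of t "- t"] generates_0
  by (metis add.right_inverse blinfun_apply_blinfun_compose blinfun_apply_id_blinfun)

lemma generates_cinner:
  "cinner (blinfun_apply (U t) x) y = cinner x (blinfun_apply (U (- t)) y)"
  using isometry_preserves_cinner[OF generates_in_bounded_ops generates_norm, of t x] generates_inverse
  by metis

text \<open>The operator \<open>U(t)\<close> commutes with the difference quotients at 0 that define the generator.\<close>

lemma generates_D:
  assumes x: "D x = Some x'"
  shows "D (blinfun_apply (U t) x) = Some (blinfun_apply (U t) x')"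
proof -
  have "((\<lambda>s. blinfun_apply (U t) (blinfun_apply (U s) x)) has_vector_derivative
      blinfun_apply (U t) (\<i> *\<^sub>C x')) (at 0)"
    using x unfolding generates_iff
    by (rule bounded_linear.has_vector_derivative[OF blinfun.bounded_linear_right])
  moreover have "blinfun_apply (U t) (blinfun_apply (U s) x) = blinfun_apply (U s) (blinfun_apply (U t) x)" for s
    by (metis add.commute blinfun_apply_blinfun_compose generates_add)
  ultimately show ?thesis
    by (simp add: generates_iff bounded_ops_scaleC[OF generates_in_bounded_ops])
qed

lemma generates_has_derivative:
  assumes x: "D x = Some x'"
  shows "((\<lambda>t. blinfun_apply (U t) x) has_vector_derivative \<i> *\<^sub>C blinfun_apply (U t) x') (at t)"
proof -
  have "((\<lambda>s. blinfun_apply (U s) (blinfun_apply (U t) x)) has_vector_derivative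
      \<i> *\<^sub>C blinfun_apply (U t) x') (at (t - t))"
    using generates_D[OF x, of t] by (simp add: generates_iff)
  with vector_diff_chain_at[of "\<lambda>s. s - t" 1 t]
  have "((\<lambda>s. blinfun_apply (U s) (blinfun_apply (U t) x)) \<circ> (\<lambda>s. s - t) has_vector_derivative
      1 *\<^sub>R \<i> *\<^sub>C blinfun_apply (U t) x') (at t)"
    by (simp add: has_vector_derivative_diff_const)
  then show ?thesis
    by (simp add: o_def blinfun_apply_blinfun_compose[symmetric] generates_add[symmetric] del: blinfun_apply_blinfun_compose)
qed

end

context self_adjoint_operator
begin

text \<open>Where the group is differentiable, moving it to the other side of the inner product shows that
  the vector lies in the domain of the adjoint of \<open>D\<close>.\<close>

theorem stone_group_generates: "generates D stone_group"
proof -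
  have "unitary_group stone_group"
    using stone_group_unitary stone_group_0 stone_group_add stone_group_continuous
    by (simp add: unitary_group_def)
  moreover have "D x = Some z"
    if x: "((\<lambda>t. blinfun_apply (stone_group t) x) has_vector_derivative \<i> *\<^sub>C z) (at 0)" for x z
  proof (rule D_eqI)
    fix y y' assume y: "D y = Some y'"
    have move: "cinner (blinfun_apply (stone_group t) x) y = cinner x (blinfun_apply (stone_group (- t)) y)" for t
    proof -
      have "blinfun_apply (stone_group t) (blinfun_apply (stone_group (- t)) y) = y"
        using stone_group_add[of t "- t"] stone_group_0
        by (metis add.right_inverse blinfun_apply_blinfun_compose blinfun_apply_id_blinfun)
      then show ?thesis
        using isometry_preserves_cinner[OF stone_group_in_bounded_ops norm_stone_group, of t x] by metis
    qed
    have "((\<lambda>t. blinfun_apply (stone_group (- t)) y) has_vector_derivative - (\<i> *\<^sub>C y')) (at 0)"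
      using vector_diff_chain_at[of uminus "-1" 0 "\<lambda>t. blinfun_apply (stone_group t) y"]
        stone_group_has_derivative[OF y] by (simp add: o_def has_vector_derivative_minus)
    then have "((\<lambda>t. cinner x (blinfun_apply (stone_group (- t)) y)) has_vector_derivative
        cinner x (- (\<i> *\<^sub>C y'))) (at 0)"
      by (rule bounded_linear.has_vector_derivative[OF cinner.bounded_linear_right])
    moreover have "((\<lambda>t. cinner (blinfun_apply (stone_group t) x) y) has_vector_derivative
        cinner (\<i> *\<^sub>C z) y) (at 0)"
      using x by (rule bounded_linear.has_vector_derivative[OF cinner.bounded_linear_left])
    ultimately have "cinner (\<i> *\<^sub>C z) y = cinner x (- (\<i> *\<^sub>C y'))"
      unfolding move by (intro vector_derivative_unique_at)
    then have "cinner z y = cinner x y'"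
      by (simp add: cinner_scaleC_left cinner_scaleC_right cinner.minus_right)
    then show "cinner y' x = cinner y z"
      by (metis cinner_commute)
  qed
  ultimately show ?thesis
    using stone_group_has_derivative unfolding generates_def by blast
qed

text \<open>On the domain of \<open>D\<close> the difference \<open>w\<close> of the two orbits stays in the domain and satisfies
  \<open>w' = i D w\<close>, hence has constant norm.\<close>

lemma generates_unique:
  assumes U: "generates D U" and V: "generates D V"
  shows "U = V"
proof
  fix t
  show "U t = V t"
  proof (rule blinfun_eqI)
    fix x
    let ?T = "\<lambda>t x. blinfun_apply (U t) x - blinfun_apply (V t) x"
    have dom: "?T t x = 0" if x: "D x = Some x'" for x x'
    proof -
      have skew: "inner (\<i> *\<^sub>C z) y = 0" if "D y = Some z" for y z
        using arg_cong[OF cinner_commute[of y z], of Im] D_symmetric[OF that that]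
        by (simp add: Re_cinner[symmetric] cinner_scaleC_left)
      have "((\<lambda>t. ?T t x) has_vector_derivative \<i> *\<^sub>C ?T s x') (at s)" for s
        unfolding scaleC_diff_right
        by (intro has_vector_derivative_diff generates_has_derivative[OF U x] generates_has_derivative[OF V x])
      moreover have "inner (\<i> *\<^sub>C ?T s x') (?T s x) = 0" for s
        by (intro skew D_diff generates_D[OF U x] generates_D[OF V x])
      ultimately have "norm (?T t x) = norm (?T 0 x)"
        by (rule norm_constant_of_orthogonal_derivative)
      then show ?thesis
        by (simp add: generates_0[OF U] generates_0[OF V])
    qed
    have "closure (dom D) \<subseteq> {x. blinfun_apply (U t) x = blinfun_apply (V t) x}"
    proof (rule closure_minimal)
      show "closed {x. blinfun_apply (U t) x = blinfun_apply (V t) x}"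
        by (intro closed_Collect_eq linear_continuous_on blinfun.bounded_linear_right)
    qed (use dom in auto)
    then show "blinfun_apply (U t) x = blinfun_apply (V t) x"
      by (auto simp: dom_dense)
  qed
qed

lemma exp_i_generates: "generates D (exp_i D)"
  unfolding exp_i_def generates_def[symmetric]
  using stone_group_generates generates_unique by (intro theI[of "generates D"])

end

section \<open>Weak derivatives as commutators\<close>

lemma norm_le_of_cinner_le_dense:
  fixes z :: "'h::complex_hilbert"
  assumes dense: "closure X = UNIV" and K: "0 \<le> K"
    and le: "\<And>y. y \<in> X \<Longrightarrow> cmod (cinner z y) \<le> K * norm y"
  shows "norm z \<le> K"
proof -
  have "closure X \<subseteq> {y. cmod (cinner z y) \<le> K * norm y}"
  proof (rule closure_minimal)
    show "closed {y. cmod (cinner z y) \<le> K * norm y}"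
      by (intro closed_Collect_le continuous_intros linear_continuous_on cinner.bounded_linear_right)
  qed (use le in auto)
  then have "cmod (cinner z z) \<le> K * norm z"
    by (auto simp: dense)
  then have "norm z * norm z \<le> K * norm z"
    by (simp add: cinner_self norm_power power2_eq_square norm_mult)
  then show ?thesis
    using K by (cases "z = 0") auto
qed

lemma blinfun_bound_from_dense:
  assumes dense: "closure X = UNIV" and le: "\<And>x. x \<in> X \<Longrightarrow> norm (blinfun_apply a x) \<le> K * norm x"
  shows "norm (blinfun_apply a x) \<le> K * norm x"
proof -
  have "closure X \<subseteq> {x. norm (blinfun_apply a x) \<le> K * norm x}"
  proof (rule closure_minimal)
    show "closed {x. norm (blinfun_apply a x) \<le> K * norm x}"
      by (intro closed_Collect_le continuous_intros linear_continuous_on blinfun.bounded_linear_right)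
  qed (use le in auto)
  then show ?thesis
    by (auto simp: dense)
qed

text \<open>The identity \<open>b = i [D, a]\<close> in the sense of forms: it makes sense before it is known that \<open>a\<close>
  preserves the domain of \<open>D\<close>, and it is visibly closed in \<open>(a, b)\<close> for the weak topology.\<close>

definition form_commutator :: "('h::complex_hilbert \<rightharpoonup> 'h) \<Rightarrow> ('h \<Rightarrow>\<^sub>L 'h) \<Rightarrow> ('h \<Rightarrow>\<^sub>L 'h) \<Rightarrow> bool" where
  "form_commutator D a b \<longleftrightarrow> (\<forall>x x' y y'. D x = Some x' \<longrightarrow> D y = Some y' \<longrightarrow>
     cinner (blinfun_apply b x) y
       = \<i> * (cinner (blinfun_apply a x) y' - cinner (blinfun_apply a x') y))"

lemma form_commutatorD:
  assumes "form_commutator D a b" "D x = Some x'" "D y = Some y'"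
  shows "cinner (blinfun_apply b x) y
    = \<i> * (cinner (blinfun_apply a x) y' - cinner (blinfun_apply a x') y)"
  using assms unfolding form_commutator_def by blast

lemma has_weak_derivative_iff_tendsto:
  "has_weak_derivative D a b \<longleftrightarrow> a \<in> bounded_ops \<and> b \<in> bounded_ops \<and>
     (\<forall>x y. ((\<lambda>t. cinner (blinfun_apply ((alpha D t a - a) /\<^sub>R t) x) y)
       \<longlongrightarrow> cinner (blinfun_apply b x) y) (at 0))"
proof -
  have "((\<lambda>t. cmod (cinner (blinfun_apply ((alpha D t a - a) /\<^sub>R t - b) x) y)) \<longlongrightarrow> 0) (at 0)
     \<longleftrightarrow> ((\<lambda>t. cinner (blinfun_apply ((alpha D t a - a) /\<^sub>R t) x) y)
       \<longlongrightarrow> cinner (blinfun_apply b x) y) (at 0)" for x y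
    by (simp only: tendsto_norm_zero_iff blinfun.diff_left cinner.diff_left LIM_zero_iff)
  then show ?thesis
    by (simp only: has_weak_derivative_def)
qed

lemma has_weak_derivative_unique:
  assumes "has_weak_derivative D a b" "has_weak_derivative D a c"
  shows "b = c"
proof (intro blinfun_eqI cinner_ext)
  fix x y
  have "cinner (blinfun_apply b x) y = cinner (blinfun_apply c x) y"
    using assms tendsto_unique[OF at_neq_bot]
    unfolding has_weak_derivative_iff_tendsto by blast
  then show "cinner y (blinfun_apply b x) = cinner y (blinfun_apply c x)"
    by (metis cinner_commute)
qed

lemma delta_w_eq: "has_weak_derivative D a b \<Longrightarrow> delta_w D a = b"
  unfolding delta_w_def using has_weak_derivative_unique by blast

lemma has_weak_derivative_delta_w: "a \<in> dom_w D \<Longrightarrow> has_weak_derivative D a (delta_w D a)"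
  unfolding dom_w_def using delta_w_eq by auto

lemma has_weak_derivative_imp_dom_w: "has_weak_derivative D a b \<Longrightarrow> a \<in> dom_w D"
  unfolding dom_w_def by auto

lemma has_uniform_derivative_imp_weak:
  fixes a :: "'h::complex_hilbert \<Rightarrow>\<^sub>L 'h"
  assumes "has_uniform_derivative D a b"
  shows "has_weak_derivative D a b"
  unfolding has_weak_derivative_def
proof (intro conjI allI)
  fix x y :: 'h
  let ?q = "\<lambda>t. (alpha D t a - a) /\<^sub>R t - b"
  have "((\<lambda>t. norm (?q t) * (norm x * norm y)) \<longlongrightarrow> 0) (at 0)"
    using assms unfolding has_uniform_derivative_def by (intro tendsto_mult_left_zero) blast
  moreover have "norm (cmod (cinner (blinfun_apply (?q t) x) y)) \<le> norm (?q t) * (norm x * norm y)" for t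
    using cmod_cinner_blinfun_le[of "?q t" x y] by (simp only: real_norm_def abs_norm_cancel mult.assoc)
  ultimately show "((\<lambda>t. cmod (cinner (blinfun_apply (?q t) x) y)) \<longlongrightarrow> 0) (at 0)"
    by (rule Lim_null_comparison[OF always_eventually[OF allI], rotated])
qed (use assms in \<open>simp_all add: has_uniform_derivative_def\<close>)

context self_adjoint_operator
begin

abbreviation "U \<equiv> exp_i D"

lemmas U_props = generates_0[OF exp_i_generates] generates_in_bounded_ops[OF exp_i_generates]
  generates_norm[OF exp_i_generates]

lemma cinner_alpha:
  "cinner (blinfun_apply (alpha D t a) x) y
    = cinner (blinfun_apply a (blinfun_apply (U (- t)) x)) (blinfun_apply (U (- t)) y)"
  by (simp add: alpha_def generates_cinner[OF exp_i_generates])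

text \<open>Both factors \<open>e\<^sup>-\<^sup>i\<^sup>t\<^sup>D x\<close> and \<open>e\<^sup>-\<^sup>i\<^sup>t\<^sup>D y\<close> are differentiable and stay in the domain, so this is the
  product rule.\<close>

lemma alpha_form_has_derivative:
  assumes a: "a \<in> bounded_ops" and x: "D x = Some x'" and y: "D y = Some y'"
  shows "((\<lambda>t. cinner (blinfun_apply (alpha D t a) x) y) has_vector_derivative
    \<i> * (cinner (blinfun_apply a (blinfun_apply (U (- t)) x)) (blinfun_apply (U (- t)) y')
       - cinner (blinfun_apply a (blinfun_apply (U (- t)) x')) (blinfun_apply (U (- t)) y))) (at t)"
proof -
  have inv: "((\<lambda>t. blinfun_apply (U (- t)) z) has_vector_derivative
      - (\<i> *\<^sub>C blinfun_apply (U (- t)) z')) (at t)" if "D z = Some z'" for z z'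
    using vector_diff_chain_at[of uminus "-1" t, OF _ generates_has_derivative[OF exp_i_generates that]]
    by (simp add: o_def has_vector_derivative_minus)
  have "((\<lambda>t. blinfun_apply a (blinfun_apply (U (- t)) x)) has_vector_derivative
      blinfun_apply a (- (\<i> *\<^sub>C blinfun_apply (U (- t)) x'))) (at t)"
    by (rule bounded_linear.has_vector_derivative[OF blinfun.bounded_linear_right inv[OF x]])
  from bounded_bilinear.has_vector_derivative[OF bounded_bilinear_cinner this inv[OF y]]
  show ?thesis
    by (simp add: cinner_alpha blinfun.minus_right bounded_ops_scaleC[OF a] cinner.minus_left
        cinner.minus_right cinner_scaleC_left cinner_scaleC_right algebra_simps)
qed

lemma form_commutator_of_weak_derivative:
  assumes "has_weak_derivative D a b"
  shows "form_commutator D a b"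
  unfolding form_commutator_def
proof (intro allI impI)
  fix x x' y y' assume x: "D x = Some x'" and y: "D y = Some y'"
  let ?c = "\<i> * (cinner (blinfun_apply a x) y' - cinner (blinfun_apply a x') y)"
  have a: "a \<in> bounded_ops"
    using assms by (simp add: has_weak_derivative_def)
  have "alpha D 0 a = a"
    by (rule blinfun_eqI) (simp add: alpha_def U_props)
  then have "((\<lambda>t. cinner (blinfun_apply ((alpha D t a - a) /\<^sub>R t) x) y - ?c) \<longlongrightarrow> 0) (at 0)"
    using alpha_form_has_derivative[OF a x y, of 0]
    by (simp add: has_vector_derivative_at_0_iff U_props blinfun.bilinear_simps cinner.diff_left
        cinner_scaleR_left)
  then have "((\<lambda>t. cinner (blinfun_apply ((alpha D t a - a) /\<^sub>R t) x) y) \<longlongrightarrow> ?c) (at 0)"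
    by (simp add: LIM_zero_iff)
  moreover have "((\<lambda>t. cinner (blinfun_apply ((alpha D t a - a) /\<^sub>R t) x) y)
      \<longlongrightarrow> cinner (blinfun_apply b x) y) (at 0)"
    using assms unfolding has_weak_derivative_iff_tendsto by blast
  ultimately show "cinner (blinfun_apply b x) y = ?c"
    by (rule tendsto_unique[OF at_neq_bot, rotated])
qed

text \<open>For vectors in the domain the form identity makes \<open>\<langle>\<alpha>\<^sub>t(b) x, y\<rangle>\<close> the derivative of
  \<open>\<langle>\<alpha>\<^sub>t(a) x, y\<rangle>\<close> at every \<open>t\<close>, and it is bounded by \<open>\<parallel>b\<parallel> \<parallel>x\<parallel> \<parallel>y\<parallel>\<close>.\<close>

lemma norm_alpha_diff_le:
  assumes a: "a \<in> bounded_ops" and form: "form_commutator D a b"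
  shows "norm (blinfun_apply (alpha D t a - a) x) \<le> norm b * \<bar>t\<bar> * norm x"
proof (rule blinfun_bound_from_dense[OF dom_dense])
  fix x assume "x \<in> dom D"
  then obtain x' where x: "D x = Some x'" by blast
  show "norm (blinfun_apply (alpha D t a - a) x) \<le> norm b * \<bar>t\<bar> * norm x"
  proof (rule norm_le_of_cinner_le_dense[OF dom_dense])
    fix y assume "y \<in> dom D"
    then obtain y' where y: "D y = Some y'" by blast
    let ?f = "\<lambda>t. cinner (blinfun_apply (alpha D t a) x) y"
    let ?f' = "\<lambda>t. cinner (blinfun_apply b (blinfun_apply (U (- t)) x)) (blinfun_apply (U (- t)) y)"
    have "(?f has_vector_derivative ?f' t) (at t)" for t
      using alpha_form_has_derivative[OF a x y, of t]
        form_commutatorD[OF form generates_D[OF exp_i_generates x] generates_D[OF exp_i_generates y]]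
      by simp
    moreover have "norm (?f' t) \<le> norm b * norm x * norm y" for t
      using cmod_cinner_blinfun_le[of b "blinfun_apply (U (- t)) x" "blinfun_apply (U (- t)) y"]
      by (simp add: U_props)
    ultimately have "norm (?f t - ?f 0) \<le> norm b * norm x * norm y * \<bar>t - 0\<bar>"
      by (rule norm_increment_le)
    then show "cmod (cinner (blinfun_apply (alpha D t a - a) x) y) \<le> norm b * \<bar>t\<bar> * norm x * norm y"
      by (simp add: cinner_alpha[of 0] U_props blinfun.diff_left cinner.diff_left mult_ac)
  qed simp
qed

text \<open>The difference quotients are bounded by \<open>\<parallel>b\<parallel>\<close>, so that convergence of their matrix
  coefficients on the domain of \<open>D\<close> implies convergence of all coefficients.\<close>

lemma weak_derivative_of_form_commutator:
  assumes a: "a \<in> bounded_ops" and b: "b \<in> bounded_ops" and form: "form_commutator D a b"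
  shows "has_weak_derivative D a b"
proof -
  let ?q = "\<lambda>t. (alpha D t a - a) /\<^sub>R t - b"
  have q_le: "norm (blinfun_apply (?q t) x) \<le> 2 * norm b * norm x" for t x
  proof -
    have "norm (blinfun_apply ((alpha D t a - a) /\<^sub>R t) x) \<le> norm b * norm x"
    proof (cases "t = 0")
      case False
      then show ?thesis
        using norm_alpha_diff_le[OF a form, of t x]
        by (simp add: blinfun.scaleR_left inverse_eq_divide pos_divide_le_eq mult_ac)
    qed simp
    then show ?thesis
      using norm_blinfun[of b x] norm_triangle_ineq4[of "blinfun_apply ((alpha D t a - a) /\<^sub>R t) x" "blinfun_apply b x"]
      by (simp add: blinfun.diff_left)
  qed
  have c_le: "norm (cinner (blinfun_apply (?q t) x) y) \<le> 2 * norm b * norm x * norm y" for t x y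
    by (rule order_trans[OF cmod_cinner_le mult_right_mono[OF q_le norm_ge_zero]])
  have 1: "((\<lambda>t. cinner (blinfun_apply (?q t) x) y) \<longlongrightarrow> 0) (at 0)"
    if x: "D x = Some x'" and y: "D y = Some y'" for x x' y y'
  proof -
    have "alpha D 0 a = a"
      by (rule blinfun_eqI) (simp add: alpha_def U_props)
    then show ?thesis
      using alpha_form_has_derivative[OF a x y, of 0] form_commutatorD[OF form x y]
      by (simp add: has_vector_derivative_at_0_iff U_props blinfun.bilinear_simps cinner.diff_left
          cinner_scaleR_left)
  qed
  have 2: "((\<lambda>t. cinner (blinfun_apply (?q t) x) y) \<longlongrightarrow> 0) (at 0)" if y: "y \<in> dom D" for x y
    by (rule tendsto_zero_from_dense[OF _ _ dom_dense, where K = "2 * norm b * norm y"])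
       (use c_le[of _ _ y] 1 y in \<open>auto simp: blinfun.add_right cinner_add_left mult_ac\<close>)
  have "((\<lambda>t. cinner (blinfun_apply (?q t) x) y) \<longlongrightarrow> 0) (at 0)" for x y
    by (rule tendsto_zero_from_dense[OF _ _ dom_dense, where K = "2 * norm b * norm x"])
       (use c_le[of _ x] 2 in \<open>auto simp: cinner_add_right\<close>)
  then show ?thesis
    using a b unfolding has_weak_derivative_def by (simp only: tendsto_norm_zero_iff simp_thms)
qed

theorem has_weak_derivative_iff_form_commutator:
  "has_weak_derivative D a b \<longleftrightarrow> a \<in> bounded_ops \<and> b \<in> bounded_ops \<and> form_commutator D a b"
  using form_commutator_of_weak_derivative weak_derivative_of_form_commutator
  unfolding has_weak_derivative_def by blast

end

section \<open>The algebra of weakly differentiable operators\<close>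

context self_adjoint_operator
begin

lemma has_weak_derivativeI:
  assumes "a \<in> bounded_ops" "b \<in> bounded_ops"
    and "\<And>x x' y y'. D x = Some x' \<Longrightarrow> D y = Some y' \<Longrightarrow>
      cinner (blinfun_apply b x) y = \<i> * (cinner (blinfun_apply a x) y' - cinner (blinfun_apply a x') y)"
  shows "has_weak_derivative D a b"
  using assms by (auto simp: has_weak_derivative_iff_form_commutator form_commutator_def)

lemma
  assumes "has_weak_derivative D a b"
  shows weakly_differentiable_in_bounded_ops: "a \<in> bounded_ops"
    and weak_derivative_in_bounded_ops: "b \<in> bounded_ops"
    and weak_derivative_form: "\<And>x x' y y'. D x = Some x' \<Longrightarrow> D y = Some y' \<Longrightarrow>
      cinner (blinfun_apply b x) y = \<i> * (cinner (blinfun_apply a x) y' - cinner (blinfun_apply a x') y)"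
  using assms by (auto simp: has_weak_derivative_iff_form_commutator dest: form_commutatorD)

lemma has_weak_derivative_zero: "has_weak_derivative D 0 0"
  by (rule has_weak_derivativeI) (simp_all add: bounded_ops_def cinner.zero_left)

lemma has_weak_derivative_add:
  assumes "has_weak_derivative D a a'" "has_weak_derivative D b b'"
  shows "has_weak_derivative D (a + b) (a' + b')"
  using assms[THEN weakly_differentiable_in_bounded_ops] assms[THEN weak_derivative_in_bounded_ops]
  by (intro has_weak_derivativeI add_in_bounded_ops)
     (simp_all add: blinfun.add_left cinner_add_left assms[THEN weak_derivative_form] algebra_simps)

lemma has_weak_derivative_scaleC:
  assumes "has_weak_derivative D a a'"
  shows "has_weak_derivative D (scaleC_op c a) (scaleC_op c a')"
  using assms[THEN weakly_differentiable_in_bounded_ops] assms[THEN weak_derivative_in_bounded_ops]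
  by (intro has_weak_derivativeI scaleC_op_in_bounded_ops)
     (simp_all add: scaleC_op_apply cinner_scaleC_left assms[THEN weak_derivative_form] algebra_simps)

text \<open>Self-adjointness of \<open>D\<close> enters here: the form identity says that \<open>a x\<close> lies in the domain of the
  adjoint of \<open>D\<close>.\<close>

lemma weakly_differentiable_preserves_dom:
  assumes a: "has_weak_derivative D a a'" and x: "D x = Some x'"
  shows "D (blinfun_apply a x) = Some (blinfun_apply a x' - \<i> *\<^sub>C blinfun_apply a' x)"
proof (rule D_eqI)
  fix y y' assume y: "D y = Some y'"
  have "cinner (blinfun_apply a x) y' = cinner (blinfun_apply a x' - \<i> *\<^sub>C blinfun_apply a' x) y"
    by (simp add: cinner.diff_left cinner_scaleC_left weak_derivative_form[OF a x y] algebra_simps)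
  then show "cinner y' (blinfun_apply a x) = cinner y (blinfun_apply a x' - \<i> *\<^sub>C blinfun_apply a' x)"
    by (metis cinner_commute)
qed

text \<open>In the form identity for \<open>a\<close>, put the vector \<open>b x\<close>, which lies in the domain.\<close>

lemma has_weak_derivative_compose:
  assumes a: "has_weak_derivative D a a'" and b: "has_weak_derivative D b b'"
  shows "has_weak_derivative D (a o\<^sub>L b) ((a' o\<^sub>L b) + (a o\<^sub>L b'))"
proof (rule has_weak_derivativeI)
  have bo: "a \<in> bounded_ops" "a' \<in> bounded_ops" "b \<in> bounded_ops" "b' \<in> bounded_ops"
    using a b weakly_differentiable_in_bounded_ops weak_derivative_in_bounded_ops by blast+
  then show "a o\<^sub>L b \<in> bounded_ops" "(a' o\<^sub>L b) + (a o\<^sub>L b') \<in> bounded_ops"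
    by (simp_all add: add_in_bounded_ops blinfun_compose_in_bounded_ops)
  fix x x' y y' assume x: "D x = Some x'" and y: "D y = Some y'"
  show "cinner (blinfun_apply ((a' o\<^sub>L b) + (a o\<^sub>L b')) x) y
      = \<i> * (cinner (blinfun_apply (a o\<^sub>L b) x) y' - cinner (blinfun_apply (a o\<^sub>L b) x') y)"
    using weak_derivative_form[OF a weakly_differentiable_preserves_dom[OF b x] y]
    by (simp add: blinfun.bilinear_simps bounded_ops_scaleC[OF bo(1)] cinner_add_left cinner.diff_left
        cinner_scaleC_left algebra_simps)
qed

lemma has_weak_derivative_adj:
  assumes a: "has_weak_derivative D a a'"
  shows "has_weak_derivative D (adj a) (adj a')"
proof (rule has_weak_derivativeI)
  have bo: "a \<in> bounded_ops" "a' \<in> bounded_ops"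
    using a weakly_differentiable_in_bounded_ops weak_derivative_in_bounded_ops by blast+
  then show "adj a \<in> bounded_ops" "adj a' \<in> bounded_ops"
    by (simp_all add: adj_in_bounded_ops)
  fix x x' y y' assume x: "D x = Some x'" and y: "D y = Some y'"
  have "cinner x (blinfun_apply a' y) = cnj (cinner (blinfun_apply a' y) x)"
    by (rule cinner_commute)
  also have "\<dots> = - \<i> * (cnj (cinner (blinfun_apply a y) x') - cnj (cinner (blinfun_apply a y') x))"
    by (simp add: weak_derivative_form[OF a y x])
  also have "\<dots> = \<i> * (cinner x (blinfun_apply a y') - cinner x' (blinfun_apply a y))"
    by (simp add: cinner_commute[symmetric] algebra_simps)
  finally show "cinner (blinfun_apply (adj a') x) y
      = \<i> * (cinner (blinfun_apply (adj a) x) y' - cinner (blinfun_apply (adj a) x') y)"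
    by (simp add: cinner_adj_left bo)
qed

lemma star_subalgebra_dom_w: "star_subalgebra (dom_w D)"
  unfolding star_subalgebra_def
proof (intro conjI ballI allI subsetI)
  note dw = has_weak_derivative_delta_w
  show "a \<in> bounded_ops" if "a \<in> dom_w D" for a
    by (rule weakly_differentiable_in_bounded_ops[OF dw[OF that]])
  show "0 \<in> dom_w D"
    by (rule has_weak_derivative_imp_dom_w[OF has_weak_derivative_zero])
  show "scaleC_op c a \<in> dom_w D" if "a \<in> dom_w D" for c a
    by (rule has_weak_derivative_imp_dom_w[OF has_weak_derivative_scaleC[OF dw[OF that]]])
  show "adj a \<in> dom_w D" if "a \<in> dom_w D" for a
    by (rule has_weak_derivative_imp_dom_w[OF has_weak_derivative_adj[OF dw[OF that]]])
  fix a b assume ab: "a \<in> dom_w D" "b \<in> dom_w D"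
  show "a + b \<in> dom_w D"
    by (rule has_weak_derivative_imp_dom_w[OF has_weak_derivative_add[OF dw[OF ab(1)] dw[OF ab(2)]]])
  show "a o\<^sub>L b \<in> dom_w D"
    by (rule has_weak_derivative_imp_dom_w[OF has_weak_derivative_compose[OF dw[OF ab(1)] dw[OF ab(2)]]])
qed

lemma star_derivation_delta_w: "star_derivation (dom_w D) (delta_w D)"
  unfolding star_derivation_def
proof (intro conjI ballI allI)
  note dw = has_weak_derivative_delta_w
  show "delta_w D a \<in> bounded_ops" if "a \<in> dom_w D" for a
    by (rule weak_derivative_in_bounded_ops[OF dw[OF that]])
  show "delta_w D (scaleC_op c a) = scaleC_op c (delta_w D a)" if "a \<in> dom_w D" for c a
    by (rule delta_w_eq[OF has_weak_derivative_scaleC[OF dw[OF that]]])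
  show "delta_w D (adj a) = adj (delta_w D a)" if "a \<in> dom_w D" for a
    by (rule delta_w_eq[OF has_weak_derivative_adj[OF dw[OF that]]])
  fix a b assume ab: "a \<in> dom_w D" "b \<in> dom_w D"
  show "delta_w D (a + b) = delta_w D a + delta_w D b"
    by (rule delta_w_eq[OF has_weak_derivative_add[OF dw[OF ab(1)] dw[OF ab(2)]]])
  show "delta_w D (a o\<^sub>L b) = (delta_w D a o\<^sub>L b) + (a o\<^sub>L delta_w D b)"
    by (rule delta_w_eq[OF has_weak_derivative_compose[OF dw[OF ab(1)] dw[OF ab(2)]]])
qed

lemma delta_w_extends_delta_u:
  assumes "a \<in> dom_u D"
  shows "a \<in> dom_w D" and "delta_w D a = delta_u D a"
proof -
  from assms obtain b where b: "has_uniform_derivative D a b"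
    by (auto simp: dom_u_def)
  have eq: "delta_w D a = c" if "has_uniform_derivative D a c" for c
    using delta_w_eq has_uniform_derivative_imp_weak that by blast
  then have "delta_u D a = b"
    unfolding delta_u_def using b by (intro the_equality) metis+
  then show "delta_w D a = delta_u D a"
    using eq[OF b] by simp
  show "a \<in> dom_w D"
    using has_uniform_derivative_imp_weak[OF b] by (rule has_weak_derivative_imp_dom_w)
qed

section \<open>Density in the strong operator topology\<close>

lemma strong_limit_in_SOT_closure:
  assumes a: "a \<in> bounded_ops" and S: "S \<subseteq> bounded_ops" and F: "F \<noteq> bot"
    and ev: "\<forall>\<^sub>F t in F. f t \<in> S"
    and lim: "\<And>x. ((\<lambda>t. blinfun_apply (f t) x) \<longlongrightarrow> blinfun_apply a x) F"
  shows "a \<in> SOT closure_of S"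
  unfolding in_closure_of
proof (intro conjI allI impI)
  show "a \<in> topspace SOT"
    by (simp add: SOT_def strong_operator_topology_topspace a)
  fix T assume "a \<in> T \<and> openin SOT T"
  then have aT: "a \<in> T" and T: "openin SOT T"
    by blast+
  then obtain V where V: "open V" "T = blinfun_apply -` V \<inter> bounded_ops"
    by (auto simp: SOT_def openin_subtopology strong_operator_topology_def openin_pullback_topology)
  have "limitin (product_topology (\<lambda>_. euclidean) UNIV) (\<lambda>t. blinfun_apply (f t)) (blinfun_apply a) F"
    by (simp add: limitin_componentwise lim)
  then have "((\<lambda>t. blinfun_apply (f t)) \<longlongrightarrow> blinfun_apply a) F"
    by (simp add: euclidean_product_topology)
  then have "\<forall>\<^sub>F t in F. blinfun_apply (f t) \<in> V"
    using V aT by (intro topological_tendstoD) auto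
  with ev have "\<forall>\<^sub>F t in F. f t \<in> S \<and> f t \<in> T"
    by eventually_elim (use S V in auto)
  then show "\<exists>y. y \<in> S \<and> y \<in> T"
    using eventually_happens'[OF F] by blast
qed

text \<open>Formally \<open>i [D, R a R] = (1 - R) a R / l - R a (1 - R) / l\<close> for the resolvent
  \<open>R = (1 + i l D)\<^sup>-\<^sup>1\<close>, because \<open>i l D R = 1 - R\<close>.\<close>

lemma resolvent_smoothing_weakly_differentiable:
  assumes a: "a \<in> bounded_ops" and l: "l \<noteq> 0"
  shows "has_weak_derivative D (resolvent l o\<^sub>L a o\<^sub>L resolvent l)
    ((1 / l) *\<^sub>R ((a o\<^sub>L resolvent l) - (resolvent l o\<^sub>L a)))"
proof (rule has_weak_derivativeI)
  let ?R = "blinfun_apply (resolvent l)" and ?c = "\<i> * complex_of_real l"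
  note R = resolvent_in_bounded_ops[OF l]
  show "resolvent l o\<^sub>L a o\<^sub>L resolvent l \<in> bounded_ops"
    "(1 / l) *\<^sub>R ((a o\<^sub>L resolvent l) - (resolvent l o\<^sub>L a)) \<in> bounded_ops"
    by (intro scaleR_in_bounded_ops diff_in_bounded_ops blinfun_compose_in_bounded_ops R a)+
  fix x x' y y' assume x: "D x = Some x'" and y: "D y = Some y'"
  let ?w = "blinfun_apply a (?R x)"
  obtain w' where w': "D (?R ?w) = Some w'" "?R ?w + ?c *\<^sub>C w' = ?w"
    by (rule resolventE[OF l])
  have left: "?c * cinner (?R ?w) y' = cinner ?w y - cinner (?R ?w) y"
    using arg_cong[OF w'(2), of "\<lambda>z. cinner z y"]
    by (simp add: D_symmetric[OF w'(1) y, symmetric] cinner_add_left cinner_scaleC_left algebra_simps)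
  have "?c *\<^sub>C ?R x' = x - ?R x"
    by (simp add: resolvent_of_dom[OF l x])
  from arg_cong[OF this, of "\<lambda>z. cinner (?R (blinfun_apply a z)) y"]
  have right: "?c * cinner (?R (blinfun_apply a (?R x'))) y = cinner (?R (blinfun_apply a x)) y - cinner (?R ?w) y"
    by (simp add: bounded_ops_scaleC[OF R] bounded_ops_scaleC[OF a] cinner_scaleC_left blinfun.diff_right
        cinner.diff_left)
  have "complex_of_real l * (\<i> * (cinner (?R ?w) y' - cinner (?R (blinfun_apply a (?R x'))) y))
      = ?c * cinner (?R ?w) y' - ?c * cinner (?R (blinfun_apply a (?R x'))) y"
    by (simp add: algebra_simps)
  also have "\<dots> = cinner ?w y - cinner (?R (blinfun_apply a x)) y"
    unfolding left right by simp
  finally show "cinner (blinfun_apply ((1 / l) *\<^sub>R ((a o\<^sub>L resolvent l) - (resolvent l o\<^sub>L a))) x) y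
      = \<i> * (cinner (blinfun_apply (resolvent l o\<^sub>L a o\<^sub>L resolvent l) x) y'
        - cinner (blinfun_apply (resolvent l o\<^sub>L a o\<^sub>L resolvent l) x') y)"
    using l by (simp add: blinfun.scaleR_left blinfun.diff_left cinner_scaleR_left cinner.diff_left
        scaleR_conv_of_real field_simps)
qed

lemma resolvent_smoothing_tendsto:
  "((\<lambda>l. blinfun_apply (resolvent l o\<^sub>L a o\<^sub>L resolvent l) x) \<longlongrightarrow> blinfun_apply a x) (at 0)"
proof -
  let ?R = "\<lambda>l. blinfun_apply (resolvent l)"
  have "((\<lambda>l. blinfun_apply a (?R l x - x)) \<longlongrightarrow> blinfun_apply a 0) (at 0)"
    by (intro bounded_linear.tendsto[OF blinfun.bounded_linear_right])
       (simp add: LIM_zero_iff resolvent_tendsto_id)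
  then have "((\<lambda>l. norm (blinfun_apply a (?R l x - x))) \<longlongrightarrow> 0) (at 0)"
    by (simp add: tendsto_norm_zero)
  moreover have "\<forall>\<^sub>F l in at 0. norm (?R l (blinfun_apply a (?R l x - x))) \<le> norm (blinfun_apply a (?R l x - x))"
    unfolding eventually_at_filter by (simp add: norm_resolvent_le)
  ultimately have "((\<lambda>l. ?R l (blinfun_apply a (?R l x - x))) \<longlongrightarrow> 0) (at 0)"
    by (rule Lim_null_comparison[rotated])
  from tendsto_add[OF this resolvent_tendsto_id[of "blinfun_apply a x"]] show ?thesis
    by (simp add: blinfun.diff_right)
qed

lemma SOT_closure_dom_w: "SOT closure_of (dom_w D) = bounded_ops"
proof
  show "SOT closure_of (dom_w D) \<subseteq> bounded_ops"
    using closure_of_subset_topspace[of SOT "dom_w D"] by (simp add: SOT_def strong_operator_topology_topspace)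
  have sub: "dom_w D \<subseteq> bounded_ops"
    using weakly_differentiable_in_bounded_ops has_weak_derivative_delta_w by blast
  show "bounded_ops \<subseteq> SOT closure_of (dom_w D)"
  proof
    fix a :: "'h \<Rightarrow>\<^sub>L 'h" assume a: "a \<in> bounded_ops"
    have "\<forall>\<^sub>F l in at 0. resolvent l o\<^sub>L a o\<^sub>L resolvent l \<in> dom_w D"
      unfolding eventually_at_filter
      by (intro always_eventually allI impI
          has_weak_derivative_imp_dom_w[OF resolvent_smoothing_weakly_differentiable[OF a]])
    then show "a \<in> SOT closure_of (dom_w D)"
      by (rule strong_limit_in_SOT_closure[OF a sub at_neq_bot _ resolvent_smoothing_tendsto])
  qed
qed

section \<open>Closedness of the graph and completeness\<close>

lemma topspace_WOT: "topspace WOT = bounded_ops"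
  by (auto simp: WOT_def weak_operator_topology_def topspace_pullback_topology)

lemma WOT_continuous_cinner:
  "continuous_map WOT euclidean (\<lambda>a. cinner (blinfun_apply a x) (y :: 'h))"
proof -
  have "continuous_map euclidean euclidean (\<lambda>g :: 'h \<times> 'h \<Rightarrow> complex. g (x, y))"
    by simp
  then have "continuous_map weak_operator_topology euclidean
      ((\<lambda>g :: 'h \<times> 'h \<Rightarrow> complex. g (x, y)) \<circ> (\<lambda>a (x, y). cinner (blinfun_apply a x) y))"
    unfolding weak_operator_topology_def by (rule continuous_map_pullback)
  then show ?thesis
    unfolding WOT_def by (intro continuous_map_from_subtopology) (simp add: o_def)
qed

lemma graph_delta_w: "{(a, delta_w D a) | a. a \<in> dom_w D} = {(a, b). has_weak_derivative D a b}"
  using has_weak_derivative_delta_w has_weak_derivative_imp_dom_w delta_w_eq by blast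

text \<open>For fixed \<open>x\<close> and \<open>y\<close> the form identity is the vanishing of a weakly continuous function of
  \<open>(a, b)\<close>, and the graph is the intersection of these zero sets.\<close>

lemma closedin_graph_delta_w:
  "closedin (prod_topology WOT WOT) {(a, delta_w D a) | a. a \<in> dom_w D}"
proof -
  define defect :: "'h \<times> 'h \<Rightarrow> ('h \<Rightarrow>\<^sub>L 'h) \<times> ('h \<Rightarrow>\<^sub>L 'h) \<Rightarrow> complex" where
    "defect q p = cinner (blinfun_apply (snd p) (fst q)) (snd q)
      - \<i> * (cinner (blinfun_apply (fst p) (fst q)) (the (D (snd q)))
        - cinner (blinfun_apply (fst p) (the (D (fst q)))) (snd q))" for q p
  let ?X = "prod_topology WOT WOT :: (('h \<Rightarrow>\<^sub>L 'h) \<times> ('h \<Rightarrow>\<^sub>L 'h)) topology"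
  have fst: "continuous_map ?X euclidean (\<lambda>p. cinner (blinfun_apply (fst p) x) y)"
    and snd: "continuous_map ?X euclidean (\<lambda>p. cinner (blinfun_apply (snd p) x) y)" for x y
    using continuous_map_compose[OF continuous_map_fst WOT_continuous_cinner]
      continuous_map_compose[OF continuous_map_snd WOT_continuous_cinner]
    by (simp_all add: o_def)
  have mult: "continuous_map ?X euclidean (\<lambda>p. \<i> * f p)" if "continuous_map ?X euclidean f" for f
    using that by (simp add: continuous_map_atin tendsto_mult)
  have "continuous_map ?X euclidean (defect q)" for q
    unfolding defect_def by (intro continuous_map_diff mult fst snd)
  then have "closedin ?X {p \<in> topspace ?X. defect q p \<in> {0}}" for q
    by (rule closedin_continuous_map_preimage) simp
  then have "closedin ?X (\<Inter>q\<in>dom D \<times> dom D. {p \<in> topspace ?X. defect q p \<in> {0}})"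
    using D_zero by (intro closedin_INT) auto
  also have "(\<Inter>q\<in>dom D \<times> dom D. {p \<in> topspace ?X. defect q p \<in> {0}}) = {(a, b). has_weak_derivative D a b}"
  proof (rule set_eqI)
    fix p :: "('h \<Rightarrow>\<^sub>L 'h) \<times> ('h \<Rightarrow>\<^sub>L 'h)"
    obtain a b where p: "p = (a, b)"
      by (rule prod.exhaust)
    have "0 \<in> dom D"
      using D_zero by blast
    then have "p \<in> (\<Inter>q\<in>dom D \<times> dom D. {p \<in> topspace ?X. defect q p \<in> {0}})
        \<longleftrightarrow> a \<in> bounded_ops \<and> b \<in> bounded_ops \<and> (\<forall>x\<in>dom D. \<forall>y\<in>dom D. defect (x, y) (a, b) = 0)"
      by (auto simp: p topspace_WOT)
    also have "(\<forall>x\<in>dom D. \<forall>y\<in>dom D. defect (x, y) (a, b) = 0) \<longleftrightarrow> form_commutator D a b"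
      unfolding form_commutator_def defect_def dom_def by auto
    finally show "p \<in> (\<Inter>q\<in>dom D \<times> dom D. {p \<in> topspace ?X. defect q p \<in> {0}})
        \<longleftrightarrow> p \<in> {(a, b). has_weak_derivative D a b}"
      by (simp add: p has_weak_derivative_iff_form_commutator)
  qed
  finally show ?thesis
    by (simp only: graph_delta_w)
qed

text \<open>This is what makes the graph norm complete: limits of a Cauchy sequence and of its derivatives
  again satisfy the form identity.\<close>

lemma has_weak_derivative_norm_limit:
  assumes ab: "\<And>n. has_weak_derivative D (f n) (g n)" and f: "f \<longlonglongrightarrow> a" and g: "g \<longlonglongrightarrow> b"
  shows "has_weak_derivative D a b"
proof (rule has_weak_derivativeI)
  have app: "(\<lambda>n. blinfun_apply (h n) x) \<longlonglongrightarrow> blinfun_apply c x" if "h \<longlonglongrightarrow> c" for h c and x :: 'h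
    using that by (intro blinfun.tendsto tendsto_const)
  have closed: "c \<in> bounded_ops" if h: "h \<longlonglongrightarrow> c" and "\<And>n. h n \<in> bounded_ops"
    for h and c :: "'h \<Rightarrow>\<^sub>L 'h"
  proof -
    have "blinfun_apply c (d *\<^sub>C x) = d *\<^sub>C blinfun_apply c x" for d x
    proof (rule LIMSEQ_unique[OF app[OF h]])
      show "(\<lambda>n. blinfun_apply (h n) (d *\<^sub>C x)) \<longlonglongrightarrow> d *\<^sub>C blinfun_apply c x"
        unfolding bounded_ops_scaleC[OF that(2)]
        by (intro bounded_linear.tendsto[OF bounded_linear_scaleC] app h)
    qed
    then show ?thesis
      by (simp add: bounded_ops_def)
  qed
  show "a \<in> bounded_ops" "b \<in> bounded_ops"
    using closed[OF f] closed[OF g] weakly_differentiable_in_bounded_ops[OF ab]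
      weak_derivative_in_bounded_ops[OF ab] by blast+
  fix x x' y y' assume x: "D x = Some x'" and y: "D y = Some y'"
  have "(\<lambda>n. cinner (blinfun_apply (g n) x) y) \<longlonglongrightarrow> cinner (blinfun_apply b x) y"
    by (intro cinner.tendsto app g tendsto_const)
  moreover have "(\<lambda>n. \<i> * (cinner (blinfun_apply (f n) x) y' - cinner (blinfun_apply (f n) x') y))
      \<longlonglongrightarrow> \<i> * (cinner (blinfun_apply a x) y' - cinner (blinfun_apply a x') y)"
    by (intro tendsto_mult tendsto_diff cinner.tendsto app f tendsto_const)
  ultimately show "cinner (blinfun_apply b x) y
      = \<i> * (cinner (blinfun_apply a x) y' - cinner (blinfun_apply a x') y)"
    unfolding weak_derivative_form[OF ab x y] by (rule LIMSEQ_unique)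
qed

lemma delta_w_zero: "delta_w D 0 = 0"
  by (rule delta_w_eq[OF has_weak_derivative_zero])

lemma has_weak_derivative_minus:
  assumes "has_weak_derivative D a b"
  shows "has_weak_derivative D (- a) (- b)"
proof -
  have "scaleC_op (- 1) c = - c" for c :: "'h \<Rightarrow>\<^sub>L 'h"
    by (rule blinfun_eqI) (simp add: scaleC_op_apply scaleC_minus_left blinfun.minus_left)
  then show ?thesis
    using has_weak_derivative_scaleC[OF assms, of "-1"] by simp
qed

lemma has_weak_derivative_diff:
  assumes "has_weak_derivative D a a'" "has_weak_derivative D b b'"
  shows "has_weak_derivative D (a - b) (a' - b')"
  using has_weak_derivative_add[OF assms(1) has_weak_derivative_minus[OF assms(2)]] by simp

abbreviation "graph_norm \<equiv> \<lambda>a. norm a + norm (delta_w D a)"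

text \<open>A metric in the sense of the library is symmetric also outside its carrier. There \<open>delta_w D\<close>
  takes one and the same default value, and the domain is closed under negation.\<close>

lemma graph_norm_minus: "graph_norm (- a) = graph_norm a"
proof (cases "a \<in> dom_w D")
  case True
  from has_weak_derivative_minus[OF has_weak_derivative_delta_w[OF this]]
  show ?thesis
    by (simp add: delta_w_eq)
next
  case False
  have "\<not> has_weak_derivative D (- a) b" for b
    using False has_weak_derivative_minus[of "- a" b] has_weak_derivative_imp_dom_w by auto
  moreover have "\<not> has_weak_derivative D a b" for b
    using False has_weak_derivative_imp_dom_w by blast
  ultimately have "delta_w D (- a) = delta_w D a"
    by (simp add: delta_w_def)
  then show ?thesis by simp
qed

lemma graph_norm_mcomplete: "Metric_space.mcomplete (dom_w D) (\<lambda>a b. graph_norm (a - b))"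
proof -
  note dw = has_weak_derivative_delta_w
  have diff: "delta_w D (a - b) = delta_w D a - delta_w D b" if "a \<in> dom_w D" "b \<in> dom_w D" for a b
    by (intro delta_w_eq has_weak_derivative_diff dw that)
  interpret M: Metric_space "dom_w D" "\<lambda>a b. graph_norm (a - b)"
  proof
    show "graph_norm (a - b) = graph_norm (b - a)" for a b
      using graph_norm_minus[of "a - b"] by simp
    show "graph_norm (a - b) = 0 \<longleftrightarrow> a = b" if "a \<in> dom_w D" "b \<in> dom_w D" for a b
      by (simp add: add_nonneg_eq_0_iff) (auto simp: delta_w_zero)
    show "graph_norm (a - c) \<le> graph_norm (a - b) + graph_norm (b - c)"
      if "a \<in> dom_w D" "b \<in> dom_w D" "c \<in> dom_w D" for a b c
      using norm_triangle_ineq[of "a - b" "b - c"]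
        norm_triangle_ineq[of "delta_w D a - delta_w D b" "delta_w D b - delta_w D c"]
      by (simp add: diff that)
  qed simp
  show ?thesis
    unfolding M.mcomplete_def
  proof (intro allI impI)
    fix s assume "M.MCauchy s"
    then have s: "\<And>n. s n \<in> dom_w D"
      and C: "\<And>e. 0 < e \<Longrightarrow> \<exists>N. \<forall>m n. N \<le> m \<longrightarrow> N \<le> n \<longrightarrow> graph_norm (s m - s n) < e"
      unfolding M.MCauchy_def by blast+
    let ?d = "\<lambda>n. delta_w D (s n)"
    have "Cauchy s"
    proof (rule CauchyI)
      fix e :: real assume "0 < e"
      from C[OF this] obtain N where N: "\<And>m n. N \<le> m \<Longrightarrow> N \<le> n \<Longrightarrow> graph_norm (s m - s n) < e"
        by blast
      have "norm (s m - s n) < e" if "N \<le> m" "N \<le> n" for m n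
        using N[OF that] norm_ge_zero[of "delta_w D (s m - s n)"] by linarith
      then show "\<exists>M. \<forall>m\<ge>M. \<forall>n\<ge>M. norm (s m - s n) < e"
        by blast
    qed
    then obtain a where a: "s \<longlonglongrightarrow> a"
      using Cauchy_convergent_iff convergent_def by blast
    have "Cauchy ?d"
    proof (rule CauchyI)
      fix e :: real assume "0 < e"
      from C[OF this] obtain N where N: "\<And>m n. N \<le> m \<Longrightarrow> N \<le> n \<Longrightarrow> graph_norm (s m - s n) < e"
        by blast
      have "norm (?d m - ?d n) < e" if "N \<le> m" "N \<le> n" for m n
        using N[OF that] norm_ge_zero[of "s m - s n"] unfolding diff[OF s s] by linarith
      then show "\<exists>M. \<forall>m\<ge>M. \<forall>n\<ge>M. norm (?d m - ?d n) < e"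
        by blast
    qed
    then obtain b where b: "?d \<longlonglongrightarrow> b"
      using Cauchy_convergent_iff convergent_def by blast
    have ab: "has_weak_derivative D a b"
      by (rule has_weak_derivative_norm_limit[OF dw[OF s] a b])
    have "(\<lambda>n. norm (s n - a) + norm (?d n - b)) \<longlonglongrightarrow> 0 + 0"
      by (intro tendsto_add tendsto_norm_zero LIM_zero a b)
    then have "(\<lambda>n. graph_norm (s n - a)) \<longlonglongrightarrow> 0"
      by (simp add: diff s has_weak_derivative_imp_dom_w[OF ab] delta_w_eq[OF ab])
    then have "limitin M.mtopology s a sequentially"
      by (simp add: M.limitin_metric_dist_null s has_weak_derivative_imp_dom_w[OF ab])
    then show "\<exists>a. limitin M.mtopology s a sequentially"
      by blast
  qed
qed

lemma banach_star_algebra_dom_w: "banach_star_algebra (dom_w D) graph_norm"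
proof -
  have add: "graph_norm (a + b) \<le> graph_norm a + graph_norm b" if "a \<in> dom_w D" "b \<in> dom_w D" for a b
    using star_derivation_delta_w that norm_triangle_ineq[of a b]
      norm_triangle_ineq[of "delta_w D a" "delta_w D b"]
    by (simp add: star_derivation_def)
  have scale: "graph_norm (scaleC_op c a) = cmod c * graph_norm a" if "a \<in> dom_w D" for c a
    using star_derivation_delta_w that by (simp add: star_derivation_def norm_scaleC_op algebra_simps)
  have mult: "graph_norm (a o\<^sub>L b) \<le> graph_norm a * graph_norm b" if "a \<in> dom_w D" "b \<in> dom_w D" for a b
  proof -
    have "norm (delta_w D (a o\<^sub>L b)) \<le> norm (delta_w D a o\<^sub>L b) + norm (a o\<^sub>L delta_w D b)"
      using star_derivation_delta_w that by (simp add: star_derivation_def norm_triangle_ineq)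
    also have "\<dots> \<le> norm (delta_w D a) * norm b + norm a * norm (delta_w D b)"
      by (intro add_mono norm_blinfun_compose)
    finally have "graph_norm (a o\<^sub>L b)
        \<le> norm a * norm b + (norm (delta_w D a) * norm b + norm a * norm (delta_w D b))"
      using norm_blinfun_compose[of a b] by linarith
    also have "\<dots> \<le> graph_norm a * graph_norm b"
      by (simp add: algebra_simps)
    finally show ?thesis .
  qed
  have adj: "graph_norm (adj a) = graph_norm a" if "a \<in> dom_w D" for a
    using star_derivation_delta_w star_subalgebra_dom_w that
    by (auto simp: star_derivation_def star_subalgebra_def norm_adj)
  show ?thesis
    unfolding banach_star_algebra_def
    using star_subalgebra_dom_w add scale mult adj graph_norm_mcomplete
    by (auto simp: add_nonneg_eq_0_iff delta_w_zero)
qed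

end

section \<open>Weak differentiability for a self-adjoint operator\<close>

theorem theorem3p9:
  fixes D :: "'h::complex_hilbert \<rightharpoonup> 'h"
  assumes "self_adjoint D"
  shows "star_subalgebra (dom_w D)
    \<and> SOT closure_of (dom_w D) = bounded_ops
    \<and> star_derivation (dom_w D) (delta_w D)
    \<and> dom_u D \<subseteq> dom_w D \<and> (\<forall>a\<in>dom_u D. delta_w D a = delta_u D a)
    \<and> closedin (prod_topology WOT WOT) {(a, delta_w D a) | a. a \<in> dom_w D}
    \<and> banach_star_algebra (dom_w D) (\<lambda>a. norm a + norm (delta_w D a))"
proof -
  interpret self_adjoint_operator D
    by standard (rule assms)
  show ?thesis
    using star_subalgebra_dom_w SOT_closure_dom_w star_derivation_delta_w delta_w_extends_delta_u
      closedin_graph_delta_w banach_star_algebra_dom_w by blast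
qed

end
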